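(* (i) There exist constants $0<c\le C<\infty$ such that for every $f\in C([0,1])$, $c\,\|f\|_{D}\le\|f\|_{\mathfrak D}\le C\,\|f\|_D$ (as elements of $[0,\infty]$). (ii) If $(W_t)_{t\ge0}$ is a standard Wiener process, then $\|W_\cdot\|_D<\infty$ almost surely. (iii) If $(W_t)_{t\ge0}$ is a standard Wiener process, then $\|W_\cdot\|_{\mathfrak D}<\infty$ almost surely. Here $W_\cdot$ denotes the path $t\mapsto W_t$ restricted to $[0,1]$.
   Context: Let $I=[0,1]$, $I_{k,l}=[l2^{-k},(l+1)2^{-k}]$ with indicator $\chi_{k,l}$. For $f\in C(I)$ and $h>0$ set $\Delta_h^2f(x)=f(x+2h)-2f(x+h)+f(x)$ if $\{x,x+h,x+2h\}\subset I$ and $\Delta^2_hf(x)=0$ otherwise (for every real $x$). For $0\le k\le j$ and $x\in I$ define $$D^2_{j,k}f(x)=\sum_{l=0}^{2^k-1}\chi_{k,l}(x)\,2^k\int_{l2^{-k}}^{(l+1)2^{-k}}|\Delta^2_{2^{-j-1}}f(t)|\,dt,\qquad \mathfrak D^2_{j,k}f(x)=2^k\int_{x-2^{-k-1}}^{x+2^{-k-1}}|\Delta^2_{2^{-j-1}}f(t)|\,dt.$$ For $0<A\le1$ let $\Phi_{2,A}(u)=u^2$ for $0<u\le1$ and $\Phi_{2,A}(u)=\exp((u^2-1)/A)$ for $u>1$ (and $\Phi_{2,A}(0)=0$), and for measurable $g$ on $I$ let $\|g\|_{2,A}=\inf\{\lambda>0:\int_I\Phi_{2,A}(|g(x)|/\lambda)\,dx\le1\}$.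 Then $$\|f\|_D=\sup_{j\in\mathbb{N}_0}\sup_{0\le k\le j}\big\|2^{j/2}D^2_{j,k}f\big\|_{2,2^{k-j}},\qquad \|f\|_{\mathfrak D}=\sup_{j\in\mathbb{N}_0}\sup_{0\le k\le j}\big\|2^{j/2}\mathfrak D^2_{j,k}f\big\|_{2,2^{k-j}}.$$ *)

theory Defs
  imports "HOL-Probability.Probability"
begin

definition Delta2 :: "(real \<Rightarrow> real) \<Rightarrow> real \<Rightarrow> real \<Rightarrow> real" where
  "Delta2 f h x = (if {x, x + h, x + 2*h} \<subseteq> {0..1}
                   then f (x + 2*h) - 2 * f (x + h) + f x else 0)"

definition dyad :: "nat \<Rightarrow> nat \<Rightarrow> real set" where
  "dyad k l = {real l / 2^k .. (real l + 1) / 2^k}"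

definition D2 :: "nat \<Rightarrow> nat \<Rightarrow> (real \<Rightarrow> real) \<Rightarrow> real \<Rightarrow> real" where
  "D2 j k f x = (\<Sum>l<2^k. indicator (dyad k l) x * (2^k *
      integral (dyad k l) (\<lambda>t. \<bar>Delta2 f (1 / 2^(j+1)) t\<bar>)))"

definition frakD2 :: "nat \<Rightarrow> nat \<Rightarrow> (real \<Rightarrow> real) \<Rightarrow> real \<Rightarrow> real" where
  "frakD2 j k f x = 2^k *
      integral {x - 1 / 2^(k+1) .. x + 1 / 2^(k+1)} (\<lambda>t. \<bar>Delta2 f (1 / 2^(j+1)) t\<bar>)"

definition Phi2 :: "real \<Rightarrow> real \<Rightarrow> real" where
  "Phi2 A u = (if u \<le> 0 then 0 else if u \<le> 1 then u^2 else exp ((u^2 - 1) / A))"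

text \<open>Orlicz (Luxemburg) norm on [0,1], valued in [0,\<infinity>] (Inf of the empty set is \<infinity>).\<close>
definition orlicz_norm :: "real \<Rightarrow> (real \<Rightarrow> real) \<Rightarrow> ennreal" where
  "orlicz_norm A g = Inf {ennreal r | r. r > 0 \<and>
      (\<integral>\<^sup>+ x. ennreal (Phi2 A (\<bar>g x\<bar> / r)) * indicator {0..1} x \<partial>lborel) \<le> 1}"

definition normD :: "(real \<Rightarrow> real) \<Rightarrow> ennreal" where
  "normD f = (SUP j::nat. SUP k\<in>{0..j}.
      orlicz_norm (2 powr (real k - real j)) (\<lambda>x. 2 powr (real j / 2) * D2 j k f x))"

definition normfrakD :: "(real \<Rightarrow> real) \<Rightarrow> ennreal" where
  "normfrakD f = (SUP j::nat. SUP k\<in>{0..j}.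
      orlicz_norm (2 powr (real k - real j)) (\<lambda>x. 2 powr (real j / 2) * frakD2 j k f x))"

definition wiener_process :: "'a measure \<Rightarrow> (real \<Rightarrow> 'a \<Rightarrow> real) \<Rightarrow> bool" where
  "wiener_process M W \<longleftrightarrow> prob_space M \<and>
     (\<forall>t\<ge>0. W t \<in> borel_measurable M) \<and>
     (AE \<omega> in M. W 0 \<omega> = 0) \<and>
     (AE \<omega> in M. continuous_on {0..} (\<lambda>t. W t \<omega>)) \<and>
     (\<forall>s t. 0 \<le> s \<and> s < t \<longrightarrow>
        distributed M lborel (\<lambda>\<omega>. W t \<omega> - W s \<omega>)
          (\<lambda>x. ennreal (normal_density 0 (sqrt (t - s)) x))) \<and>
     (\<forall>(ts::nat \<Rightarrow> real) n. 0 \<le> ts 0 \<and> (\<forall>i<n. ts i \<le> ts (Suc i)) \<longrightarrow>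
        prob_space.indep_vars M (\<lambda>_. borel) (\<lambda>i \<omega>. W (ts (Suc i)) \<omega> - W (ts i) \<omega>) {..<n})"

end

(*
Up to the finitely many dyadic points, a centred average is at most the sum of the dyadic averages at
x - 2^-k, x, x + 2^-k, and a dyadic average is at most the sum of the centred averages at
x - 2^(-k-1), x, x + 2^(-k-1). Translates of a function supported in [0,1] have the same modular, and
Phi(u/2) <= Phi(u)/3, so the norms are comparable with constant 6.

For a Wiener path, put n = 2^(j-k). The scaled second difference at t is controlled by two standard
normal half step increments, and a dyadic average is an average over u in [0,1] of a mean over n
blocks of length 2^-j. By Jensen's inequality for x |-> exp(n x^2/8) and the Cauchy-Schwarz inequality,
  Phi(X_l / 8) <= 1/2 + int_0^1 Y_l(u) du,   Y_l = exp(-4n) prod_p exp(eta_p^2/8),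
where p runs over the 2n half steps of the l-th dyadic interval of level k. For fixed u the Y_l are
independent with mean at most 1/4 and second moment at most 2^(k-j), so their mean over the 2^k values
of l has variance at most 2^-j. Integrating in u and summing over k <= j, then j, shows that almost
surely all but finitely many pairs (j,k) give Orlicz norm at most 8; the others are finite because the
averages are bounded.
*)
theory Submission
  imports Defs
begin

section \<open>The Young function and its Luxemburg norm\<close>

lemma Phi2_mono:
  assumes "0 < A" "u \<le> v"
  shows "Phi2 A u \<le> Phi2 A v"
proof -
  have 1: "u^2 \<le> 1 \<and> 1 \<le> exp ((v^2 - 1) / A)" if "0 < u" "u \<le> 1" "1 < v"
  proof -
    have "1 \<le> v^2" "u^2 \<le> 1" using that by (auto simp: one_le_power power_le_one)
    then show ?thesis using \<open>0 < A\<close> by simp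
  qed
  have 2: "u^2 \<le> v^2" if "0 < u" using that assms by (simp add: power_mono)
  have 3: "(u\<^sup>2 - 1) / A \<le> (v\<^sup>2 - 1) / A" if "0 < u"
    using 2[OF that] \<open>0 < A\<close> by (simp add: divide_right_mono)
  show ?thesis
    using assms 1 2 3 unfolding Phi2_def by (auto intro: order_trans)
qed

lemma Phi2_nonneg: "0 \<le> Phi2 A u"
  by (simp add: Phi2_def)

text \<open>This replaces the convexity of the Young
  function when a maximum of three translates is estimated by their sum.\<close>

lemma Phi2_half:
  assumes "0 < A" "A \<le> 1"
  shows "Phi2 A (u / 2) \<le> Phi2 A u / 3"
proof -
  consider "u \<le> 0" | "0 < u" "u \<le> 1" | "1 < u" "u \<le> 2" | "2 < u" by linarith
  then show ?thesis
  proof cases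
    case 3
    \<comment> \<open>Here Phi(u/2) = u^2/4, and e^t >= 1 + t at t = u^2 - 1 gives Phi(u) >=
      u^2.\<close>
    have "1 \<le> u^2" using 3 by (simp add: one_le_power)
    have "u^2 \<le> exp (u^2 - 1)" using exp_ge_add_one_self[of "u^2 - 1"] by simp
    also have "\<dots> \<le> exp ((u^2 - 1) / A)"
      using assms \<open>1 \<le> u^2\<close> by (simp add: pos_le_divide_eq mult_left_le)
    finally have "3 * u^2 \<le> exp ((u^2 - 1) / A) * 4" using \<open>1 \<le> u^2\<close> by linarith
    then show ?thesis using 3 by (simp add: Phi2_def power_divide)
  next
    case 4
    \<comment> \<open>The exponents at u and u/2 differ by 3u^2/(4A) >= 3, so the quotient of the
      two values exceeds 3.\<close>
    have "4 \<le> u^2" using 4 power_mono[of 2 u 2] by simp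
    have "3 \<le> (3::real) * 1" by simp
    also have "\<dots> \<le> 3 * u^2 / (4 * A)" using assms \<open>4 \<le> u^2\<close> by (simp add: field_simps)
    finally have "3 \<le> 3 * u^2 / (4 * A)" .
    then have "3 \<le> exp (3 * u^2 / (4 * A))" using exp_ge_add_one_self[of "3 * u^2 / (4 * A)"] by linarith
    moreover have "exp ((u^2 - 1) / A) = exp (((u / 2)^2 - 1) / A) * exp (3 * u^2 / (4 * A))"
      unfolding exp_add[symmetric] using assms by (simp add: field_simps)
    ultimately show ?thesis using 4
      by (simp add: Phi2_def field_simps)
  qed (auto simp: Phi2_def power_divide)
qed

lemma borel_measurable_Phi2 [measurable]: "Phi2 A \<in> borel_measurable borel"
  unfolding Phi2_def by measurable

lemma orlicz_norm_le:
  assumes "r > 0"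
    and "(\<integral>\<^sup>+ x. ennreal (Phi2 A (\<bar>g x\<bar> / r)) * indicator {0..1} x \<partial>lborel) \<le> 1"
  shows "orlicz_norm A g \<le> ennreal r"
  unfolding orlicz_norm_def using assms by (intro Inf_lower) auto

lemma orlicz_norm_bounded:
  assumes "0 < A" and bound: "\<And>x. x \<in> {0..1} \<Longrightarrow> \<bar>g x\<bar> \<le> B"
  shows "orlicz_norm A g < \<infinity>"
proof -
  \<comment> \<open>The maximum with 1 keeps the scale positive; every value |g x| / r is then at
    most 1, where Phi equals 1.\<close>
  define r where "r = max B 1"
  have "(\<integral>\<^sup>+ x. ennreal (Phi2 A (\<bar>g x\<bar> / r)) * indicator {0..1} x \<partial>lborel)
      \<le> (\<integral>\<^sup>+ x. indicator {0..1::real} x \<partial>lborel)"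
  proof (intro nn_integral_mono)
    fix x :: real
    have "Phi2 A (\<bar>g x\<bar> / r) \<le> Phi2 A 1" if "x \<in> {0..1}"
      using bound[OF that] \<open>0 < A\<close> by (intro Phi2_mono) (auto simp: r_def divide_simps)
    then show "ennreal (Phi2 A (\<bar>g x\<bar> / r)) * indicator {0..1} x \<le> indicator {0..1} x"
      by (auto simp: Phi2_def indicator_def)
  qed
  also have "\<dots> = 1" by simp
  finally have "orlicz_norm A g \<le> ennreal r"
    by (intro orlicz_norm_le) (auto simp: r_def)
  then show ?thesis by (simp add: order.strict_trans1)
qed

text \<open>With m the largest of the three values of v, |u| / (6r) is at most half of m / r. Then
  \<open>Phi2_half\<close> bounds the modular of u / (6r) by a third of the sum of the three
  translated modulars of v / r, each of which is at most 1.\<close>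

lemma orlicz_norm_translates:
  fixes u v :: "real \<Rightarrow> real"
  assumes A: "0 < A" "A \<le> 1"
    and v [measurable]: "v \<in> borel_measurable borel"
    and v_nonneg: "\<And>x. 0 \<le> v x" and v_supp: "\<And>x. x \<notin> {0..1} \<Longrightarrow> v x = 0"
    and le: "AE x in lborel. x \<in> {0..1} \<longrightarrow> \<bar>u x\<bar> \<le> v (x - s) + v x + v (x + s)"
  shows "orlicz_norm A u \<le> 6 * orlicz_norm A v"
proof -
  \<comment> \<open>Dividing by 6 first isolates r on the right, so the infimum over r can be taken
    directly.\<close>
  have "orlicz_norm A u / 6 \<le> ennreal r"
    if r: "r > 0" "(\<integral>\<^sup>+ x. ennreal (Phi2 A (\<bar>v x\<bar> / r)) * indicator {0..1} x \<partial>lborel) \<le> 1" for r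
  proof -
    \<comment> \<open>Phi vanishes at 0 and v outside [0,1], so the integral of w over the whole
      line is a third of the modular of v / r and is invariant under translation.\<close>
    define w where "w x = ennreal (Phi2 A (v x / r) / 3)" for x
    have [measurable]: "w \<in> borel_measurable borel" unfolding w_def by measurable
    have "(\<integral>\<^sup>+ x. w x \<partial>lborel) =
        (\<integral>\<^sup>+ x. ennreal (1/3) * (ennreal (Phi2 A (\<bar>v x\<bar> / r)) * indicator {0..1} x) \<partial>lborel)"
    proof (intro nn_integral_cong)
      fix x
      show "w x = ennreal (1/3) * (ennreal (Phi2 A (\<bar>v x\<bar> / r)) * indicator {0..1} x)"
      proof (cases "x \<in> {0..1}")
        case True
        have "ennreal (1/3) * ennreal (Phi2 A (v x / r)) = ennreal (Phi2 A (v x / r) / 3)"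
          by (subst ennreal_mult[symmetric]) (auto simp: Phi2_nonneg)
        then show ?thesis using True v_nonneg[of x] by (simp add: w_def)
      next
        case False
        then show ?thesis using v_supp by (simp add: w_def Phi2_def)
      qed
    qed
    also have "\<dots> = ennreal (1/3) * (\<integral>\<^sup>+ x. ennreal (Phi2 A (\<bar>v x\<bar> / r)) * indicator {0..1} x \<partial>lborel)"
      by (intro nn_integral_cmult) measurable
    also have "\<dots> \<le> ennreal (1/3) * 1" by (intro mult_left_mono r) simp
    finally have w: "(\<integral>\<^sup>+ x. w x \<partial>lborel) \<le> ennreal (1/3)" by simp
    have shift: "(\<integral>\<^sup>+ x. w (c + x) \<partial>lborel) \<le> ennreal (1/3)" for c
      using nn_integral_real_affine[of w 1 c] w by simp
    have "(\<integral>\<^sup>+ x. ennreal (Phi2 A (\<bar>u x\<bar> / (6 * r))) * indicator {0..1} x \<partial>lborel)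
        \<le> (\<integral>\<^sup>+ x. w (-s + x) + w (0 + x) + w (s + x) \<partial>lborel)"
    proof (intro nn_integral_mono_AE, use le in eventually_elim)
      fix x assume le: "x \<in> {0..1} \<longrightarrow> \<bar>u x\<bar> \<le> v (x - s) + v x + v (x + s)"
      show "ennreal (Phi2 A (\<bar>u x\<bar> / (6 * r))) * indicator {0..1} x
          \<le> w (-s + x) + w (0 + x) + w (s + x)"
      proof (cases "x \<in> {0..1}")
        case True
        define m where "m = Max {v (x - s), v x, v (x + s)}"
        have m: "v (x - s) \<le> m" "v x \<le> m" "v (x + s) \<le> m" by (auto simp: m_def)
        have "m \<in> {v (x - s), v x, v (x + s)}" unfolding m_def by (rule Max_in) auto
        moreover have "\<bar>u x\<bar> / (6 * r) \<le> (m / r) / 2"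
          using le True m r(1) by (simp add: field_simps)
        then have "Phi2 A (\<bar>u x\<bar> / (6 * r)) \<le> Phi2 A (m / r) / 3"
          using Phi2_mono[OF A(1)] Phi2_half[OF A] order_trans by blast
        ultimately have "ennreal (Phi2 A (\<bar>u x\<bar> / (6 * r))) \<in> {..w (x - s)} \<union> {..w x} \<union> {..w (x + s)}"
          by (auto simp: w_def intro: ennreal_leI)
        then show ?thesis using True
          by (auto simp: add.commute[of s] intro: order_trans add_increasing add_increasing2)
      qed auto
    qed
    also have "\<dots> = (\<integral>\<^sup>+ x. w (-s + x) \<partial>lborel) + (\<integral>\<^sup>+ x. w (0 + x) \<partial>lborel) + (\<integral>\<^sup>+ x. w (s + x) \<partial>lborel)"
      by (simp add: nn_integral_add)
    also have "\<dots> \<le> ennreal (1/3) + ennreal (1/3) + ennreal (1/3)"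
      by (intro add_mono shift)
    also have "\<dots> = 1" by (simp flip: ennreal_plus)
    finally have "orlicz_norm A u \<le> ennreal (6 * r)"
      using r by (intro orlicz_norm_le) auto
    also have "\<dots> = 6 * ennreal r" using r(1) by (simp add: ennreal_mult)
    finally have "orlicz_norm A u / 6 \<le> (6 * ennreal r) / 6" by (rule divide_right_mono_ennreal)
    then show ?thesis by (simp add: mult.commute[of 6] mult_divide_eq_ennreal)
  qed
  then have "orlicz_norm A u / 6 \<le> orlicz_norm A v"
    unfolding orlicz_norm_def[of A v] by (intro Inf_greatest) auto
  then have "6 * (orlicz_norm A u / 6) \<le> 6 * orlicz_norm A v" by (rule mult_left_mono) simp
  then show ?thesis by (simp add: ennreal_times_divide mult.commute[of 6] mult_divide_eq_ennreal)
qed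

section \<open>Second differences: support and integrability\<close>

lemma Delta2_eq_0: "0 < h \<Longrightarrow> x < 0 \<or> 1 < x + 2 * h \<Longrightarrow> Delta2 f h x = 0"
  by (auto simp: Delta2_def)

lemma Delta2_cong:
  "(\<And>x. x \<in> {0..1} \<Longrightarrow> f x = g x) \<Longrightarrow> Delta2 f h = Delta2 g h"
  by (auto simp: Delta2_def fun_eq_iff)

text \<open>The second difference may jump to 0 at the ends of [0, 1 - 2h], so it is handled as the
  extension by zero of a continuous function on that interval.\<close>

lemma integrable_abs_Delta2:
  assumes f: "continuous_on {0..1} f" and "0 < h" "2 * h \<le> 1"
  shows "(\<lambda>t. \<bar>Delta2 f h t\<bar>) integrable_on {a..b}"
proof -
  have "continuous_on {0..1 - 2 * h} (\<lambda>t. \<bar>f (t + 2 * h) - 2 * f (t + h) + f t\<bar>)"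
    using assms by (intro continuous_intros continuous_on_compose2[OF f]) auto
  then have "(\<lambda>t. \<bar>f (t + 2 * h) - 2 * f (t + h) + f t\<bar>) integrable_on {0..1 - 2 * h}"
    by (rule integrable_continuous_real)
  then have "(\<lambda>t. if t \<in> {0..1 - 2 * h} then \<bar>f (t + 2 * h) - 2 * f (t + h) + f t\<bar> else 0) integrable_on UNIV"
    by (subst integrable_restrict_UNIV)
  also have "(\<lambda>t. if t \<in> {0..1 - 2 * h} then \<bar>f (t + 2 * h) - 2 * f (t + h) + f t\<bar> else 0)
      = (\<lambda>t. \<bar>Delta2 f h t\<bar>)"
    using assms by (auto simp: Delta2_def fun_eq_iff)
  finally show ?thesis by (rule integrable_on_subinterval) simp
qed

section \<open>Comparison of dyadic and centred averages\<close>

text \<open>Real endpoints give one notation for dyadic intervals, centred windows and pieces of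
  both, including windows that leave [0,1].\<close>

definition osc_integral :: "nat \<Rightarrow> (real \<Rightarrow> real) \<Rightarrow> real \<Rightarrow> real \<Rightarrow> real" where
  "osc_integral j f a b = integral {a..b} (\<lambda>t. \<bar>Delta2 f (1 / 2^(j+1)) t\<bar>)"

text \<open>For arbitrary f the integrand may fail to be integrable; the gauge integral is then 0 by
  convention.\<close>

lemma osc_integral_nonneg: "0 \<le> osc_integral j f a b"
  unfolding osc_integral_def
  by (cases "(\<lambda>t. \<bar>Delta2 f (1 / 2^(j+1)) t\<bar>) integrable_on {a..b}")
     (auto intro: integral_nonneg simp: not_integrable_integral)

lemma integrable_osc:
  "continuous_on {0..1} f \<Longrightarrow> (\<lambda>t. \<bar>Delta2 f (1 / 2^(j+1)) t\<bar>) integrable_on {a..b}"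
  by (rule integrable_abs_Delta2) auto

lemma osc_integral_mono:
  "continuous_on {0..1} f \<Longrightarrow> a' \<le> a \<Longrightarrow> b \<le> b' \<Longrightarrow> osc_integral j f a b \<le> osc_integral j f a' b'"
  unfolding osc_integral_def
  by (intro integral_subset_le integrable_osc) auto

lemma osc_integral_combine:
  "continuous_on {0..1} f \<Longrightarrow> a \<le> b \<Longrightarrow> b \<le> c \<Longrightarrow>
    osc_integral j f a b + osc_integral j f b c = osc_integral j f a c"
  unfolding osc_integral_def
  by (intro Henstock_Kurzweil_Integration.integral_combine integrable_osc) auto

lemma osc_integral_outside:
  assumes "b \<le> 0 \<or> 1 \<le> a"
  shows "osc_integral j f a b = 0"
proof -
  have "integral {a..b} (\<lambda>t. \<bar>Delta2 f (1 / 2^(j+1)) t\<bar>) = integral {a..b} (\<lambda>t. 0)"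
  \<comment> \<open>If b = 0, the endpoint t = 0 is the only place where the second difference can
    be nonzero; for t >= 1 the point t + 2h leaves [0,1].\<close>
  proof (rule integral_spike[of "{0}"])
    fix t assume t: "t \<in> {a..b} - {0}"
    have h: "(0::real) < 1 / 2^(j+1)" by simp
    have "t < 0 \<or> 1 < t + 2 * (1 / 2^(j+1))" using assms t h by (smt (verit) DiffE atLeastAtMost_iff singletonI)
    then show "0 = \<bar>Delta2 f (1 / 2^(j+1)) t\<bar>" using Delta2_eq_0[OF h] by simp
  qed auto
  then show ?thesis by (simp add: osc_integral_def)
qed

text \<open>Adjacent closed dyadic intervals share an endpoint, where \<open>D2\<close> can add two
  averages. Outside this null set at most one interval of level k contains x.\<close>

lemma AE_not_dyadic: "AE x::real in lborel. x * 2^k \<notin> \<int>"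
proof -
  have "{x::real. x * 2^k \<in> \<int>} \<subseteq> range (\<lambda>z::int. of_int z / 2^k)"
    by (auto simp: Ints_def field_simps)
  then have "countable {x::real. x * 2^k \<in> \<int>}"
    by (rule countable_subset) simp
  then have "{x::real. x * 2^k \<in> \<int>} \<in> null_sets lborel"
    by (rule countable_imp_null_set_lborel)
  from AE_not_in[OF this] show ?thesis by simp
qed

lemma mem_dyad_iff_floor:
  assumes "x * 2^k \<notin> \<int>"
  shows "x \<in> dyad k l \<longleftrightarrow> int l = \<lfloor>x * 2^k\<rfloor>"
proof -
  have "x * 2^k \<noteq> real l + 1"
    using assms by (metis Ints_of_nat Ints_1 Ints_add)
  moreover have "x \<in> dyad k l \<longleftrightarrow> real l \<le> x * 2^k \<and> x * 2^k \<le> real l + 1"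
    by (auto simp: dyad_def field_simps)
  ultimately show ?thesis by (auto simp: eq_commute[of "int l"] floor_eq_iff)
qed

text \<open>This covers x outside [0,1]: there the index leaves the range of the sum, and the
  integral over that interval vanishes. Neighbouring averages therefore require no boundary
  cases.\<close>

lemma D2_floor:
  assumes x: "x * 2^k \<notin> \<int>"
  shows "D2 j k f x = 2^k * osc_integral j f (of_int \<lfloor>x * 2^k\<rfloor> / 2^k) ((of_int \<lfloor>x * 2^k\<rfloor> + 1) / 2^k)"
proof -
  let ?F = "\<lambda>m::int. 2^k * osc_integral j f (of_int m / 2^k) ((of_int m + 1) / 2^k)"
  define m where "m = \<lfloor>x * 2^k\<rfloor>"
  have "D2 j k f x = (\<Sum>l<2^k. if int l = m then ?F m else 0)"
    unfolding D2_def
  proof (intro sum.cong refl)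
    fix l
    show "indicator (dyad k l) x * (2^k * integral (dyad k l) (\<lambda>t. \<bar>Delta2 f (1 / 2^(j+1)) t\<bar>))
        = (if int l = m then ?F m else 0)"
    proof (cases "int l = m")
      case True
      then have "x \<in> dyad k l" "real_of_int m = real l" by (auto simp: mem_dyad_iff_floor[OF x] m_def)
      then show ?thesis
        using True unfolding \<open>real_of_int m = real l\<close> osc_integral_def dyad_def by simp
    next
      case False
      then have "x \<notin> dyad k l" by (simp add: mem_dyad_iff_floor[OF x] m_def)
      then show ?thesis using False by simp
    qed
  qed
  also have "\<dots> = ?F m"
  proof (cases "0 \<le> m \<and> m < 2^k")
    case True
    then have "\<And>l. int l = m \<longleftrightarrow> l = nat m" "nat m < 2^k" by (auto simp: nat_less_iff)
    then show ?thesis by (auto simp: sum.delta')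
  next
    case False
    then have "real_of_int (m + 1) \<le> real_of_int 0 \<or> real_of_int (2^k) \<le> real_of_int m"
      unfolding of_int_le_iff by linarith
    then have "real_of_int m + 1 \<le> 0 \<or> 2^k \<le> real_of_int m" by simp
    then have "(real_of_int m + 1) / 2^k \<le> 0 \<or> 1 \<le> real_of_int m / 2^k"
      by (auto simp: field_simps)
    moreover have "int l \<noteq> m" if "l < 2^k" for l
      using False that by (metis of_nat_0_le_iff of_nat_less_iff of_nat_numeral of_nat_power)
    ultimately show ?thesis by (auto simp: osc_integral_outside)
  qed
  finally show ?thesis by (simp add: m_def)
qed

lemma frakD2_osc: "frakD2 j k f x = 2^k * osc_integral j f (x - 1 / 2^(k+1)) (x + 1 / 2^(k+1))"
  by (simp add: frakD2_def osc_integral_def)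

lemma D2_nonneg: "0 \<le> D2 j k f x"
proof -
  have "0 \<le> integral (dyad k l) (\<lambda>t. \<bar>Delta2 f (1 / 2^(j+1)) t\<bar>)" for l
    using osc_integral_nonneg by (auto simp: osc_integral_def dyad_def)
  then show ?thesis unfolding D2_def by (intro sum_nonneg) auto
qed

lemma frakD2_nonneg: "0 \<le> frakD2 j k f x"
  by (simp add: frakD2_osc osc_integral_nonneg)

lemma D2_outside:
  assumes "x \<notin> {0..1}" shows "D2 j k f x = 0"
proof -
  have "x \<notin> dyad k l" if "l < 2^k" for l
  proof -
    have "real (l + 1) \<le> real (2^k)" using that unfolding of_nat_le_iff by simp
    then have "0 \<le> real l / 2^k" "(real l + 1) / 2^k \<le> 1" by auto
    then show ?thesis using assms unfolding dyad_def atLeastAtMost_iff by linarith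
  qed
  then show ?thesis by (simp add: D2_def)
qed

lemma borel_measurable_D2 [measurable]: "D2 j k f \<in> borel_measurable borel"
  unfolding D2_def[abs_def] dyad_def by measurable

text \<open>The window of half width 2^(-k-1) around x is covered by the dyadic interval of x and
  its two neighbours, which are the dyadic intervals of x - 2^-k and x + 2^-k.\<close>

lemma frakD2_le_D2:
  assumes f: "continuous_on {0..1} f" and x: "x * 2^k \<notin> \<int>"
  shows "frakD2 j k f x \<le> D2 j k f (x - 1 / 2^k) + D2 j k f x + D2 j k f (x + 1 / 2^k)"
proof -
  define d where "d = 1 / (2::real)^k"
  define m where "m = \<lfloor>x * 2^k\<rfloor>"
  have d: "0 < d" and d2: "1 / 2^(k+1) = d / 2" and kd: "2^k * d = 1" by (auto simp: d_def)
  have x': "(x - d) * 2^k = x * 2^k - 1" "(x + d) * 2^k = x * 2^k + 1"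
    using kd by (auto simp: algebra_simps)
  have ni: "(x - d) * 2^k \<notin> \<int>" "(x + d) * 2^k \<notin> \<int>"
    using x unfolding x' by (metis Ints_1 Ints_add Ints_diff add_diff_cancel_right' diff_add_cancel)+
  have fl: "\<lfloor>(x - d) * 2^k\<rfloor> = m - 1" "\<lfloor>(x + d) * 2^k\<rfloor> = m + 1" unfolding x' m_def by simp_all
  let ?m = "real_of_int m"
  have mx: "?m * d \<le> x" "x \<le> (?m + 1) * d"
    using floor_correct[of "x * 2^k"] by (auto simp: m_def d_def field_simps)
  have "osc_integral j f (x - d / 2) (x + d / 2) \<le> osc_integral j f ((?m - 1) * d) ((?m + 2) * d)"
    using mx d by (intro osc_integral_mono f) (auto simp: algebra_simps)
  also have "\<dots> = osc_integral j f ((?m - 1) * d) (?m * d) + osc_integral j f (?m * d) ((?m + 1) * d)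
      + osc_integral j f ((?m + 1) * d) ((?m + 2) * d)"
    using d by (simp add: osc_integral_combine[OF f])
  finally have "2^k * osc_integral j f (x - d / 2) (x + d / 2) \<le> 2^k * \<dots>" by (rule mult_left_mono) simp
  then show ?thesis
    unfolding frakD2_osc d2 d_def[symmetric] D2_floor[OF x] D2_floor[OF ni(1)] D2_floor[OF ni(2)] fl
      m_def[symmetric]
    by (simp add: d_def algebra_simps)
qed

text \<open>Split the dyadic interval at its midpoint. If x lies in the left half, the windows
  around x and x + 2^(-k-1) cover the two halves, and the second centre stays in the same dyadic
  interval; the other case is symmetric. The function g stands for a cutoff of \<open>frakD2\<close>
  to [0,1], as \<open>orlicz_norm_translates\<close> demands.\<close>

lemma D2_le_frakD2:
  assumes f: "continuous_on {0..1} f" and x: "x * 2^k \<notin> \<int>" "x \<in> {0..1}"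
    and g: "\<And>y. y \<in> {0..1} \<Longrightarrow> g y = frakD2 j k f y" "\<And>y. 0 \<le> g y"
  shows "D2 j k f x \<le> g (x - 1 / 2^(k+1)) + g x + g (x + 1 / 2^(k+1))"
proof -
  define d where "d = 1 / (2::real)^k"
  define m where "m = \<lfloor>x * 2^k\<rfloor>"
  have d: "0 < d" and d2: "1 / 2^(k+1) = d / 2" by (auto simp: d_def)
  let ?m = "real_of_int m"
  have mx: "?m * d \<le> x" "x \<le> (?m + 1) * d"
    using floor_correct[of "x * 2^k"] by (auto simp: m_def d_def field_simps)
  \<comment> \<open>At x = 1 the floor would be 2^k, one past the last interval; that point is
    excluded as dyadic.\<close>
  have "(2::real)^k \<in> \<int>" by (intro Ints_power) simp
  then have "x * 2^k \<noteq> 2^k" using x(1) by auto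
  moreover have "x * 2^k \<le> 2^k" using x(2) by simp
  ultimately have "x * 2^k < 2^k" by linarith
  then have "m < 2^k" "0 \<le> m" unfolding m_def using x(2) by (auto simp: floor_less_iff)
  then have "real_of_int (m + 1) \<le> real_of_int (2^k)" unfolding of_int_le_iff by simp
  then have m01: "0 \<le> ?m * d" "(?m + 1) * d \<le> 1"
    using \<open>0 \<le> m\<close> by (auto simp: d_def)
  let ?c = "?m * d + d / 2"
  have D: "D2 j k f x = 2^k * osc_integral j f (?m * d) ?c + 2^k * osc_integral j f ?c ((?m + 1) * d)"
    unfolding D2_floor[OF x(1)] m_def[symmetric] distrib_left[symmetric] using d
    by (subst osc_integral_combine[OF f]) (auto simp: field_simps d_def)
  have fr: "frakD2 j k f y = 2^k * osc_integral j f (y - d / 2) (y + d / 2)" for y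
    unfolding frakD2_osc d2 ..
  show ?thesis
  proof (cases "x \<le> ?c")
    case True
    have "D2 j k f x \<le> frakD2 j k f x + frakD2 j k f (x + d / 2)"
      unfolding D fr using True mx d
      by (intro add_mono mult_left_mono osc_integral_mono f) (auto simp: algebra_simps)
    moreover have "x + d / 2 \<in> {0..1}" using True m01 x d by (auto simp: algebra_simps)
    ultimately show ?thesis unfolding d2 using g(1)[of x] g(1)[of "x + d / 2"] g(2)[of "x - d / 2"] x
      by simp
  next
    case False
    have "D2 j k f x \<le> frakD2 j k f (x - d / 2) + frakD2 j k f x"
      unfolding D fr using False mx d
      by (intro add_mono mult_left_mono osc_integral_mono f) (auto simp: algebra_simps)
    moreover have "x - d / 2 \<in> {0..1}" using False m01 x d by (auto simp: algebra_simps)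
    ultimately show ?thesis unfolding d2 using g(1)[of x] g(1)[of "x - d / 2"] g(2)[of "x + d / 2"] x
      by simp
  qed
qed

text \<open>Supplies the measurability of the cutoff in \<open>normD_le\<close>. The window integral
  is a difference of two values of an indefinite integral based at -1, to the left of every
  window.\<close>

lemma continuous_on_frakD2:
  assumes f: "continuous_on {0..1} f"
  shows "continuous_on {0..1} (frakD2 j k f)"
proof -
  define d where "d = 1 / (2::real)^(k+1)"
  have d: "0 < d" "d \<le> 1" unfolding d_def using one_le_power[of "2::real" "k+1"] by (auto simp: divide_simps simp del: power_Suc)
  let ?g = "osc_integral j f (-1)"
  have g: "continuous_on {-1..2} ?g"
    unfolding osc_integral_def by (rule indefinite_integral_continuous_1[OF integrable_osc[OF f]])
  have "continuous_on {0..1} (\<lambda>x. 2^k * (?g (x + d) - ?g (x - d)))"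
    using d by (intro continuous_intros continuous_on_compose2[OF g]) auto
  moreover have "frakD2 j k f x = 2^k * (?g (x + d) - ?g (x - d))" if "x \<in> {0..1}" for x
    using osc_integral_combine[OF f, of "-1" "x - d" "x + d" j] that d
    unfolding frakD2_osc d_def[symmetric] by simp
  ultimately show ?thesis by (simp cong: continuous_on_cong_simp)
qed

lemma orlicz_norm_cong:
  "(\<And>x. x \<in> {0..1} \<Longrightarrow> u x = v x) \<Longrightarrow> orlicz_norm A u = orlicz_norm A v"
proof -
  assume "\<And>x. x \<in> {0..1} \<Longrightarrow> u x = v x"
  then have "ennreal (Phi2 A (\<bar>u x\<bar> / r)) * indicator {0..1} x
      = ennreal (Phi2 A (\<bar>v x\<bar> / r)) * indicator {0..1} x" for r x
    by (auto simp: indicator_def)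
  then show ?thesis unfolding orlicz_norm_def by simp
qed

lemma normfrakD_le:
  assumes f: "continuous_on {0..1} f"
  shows "normfrakD f \<le> 6 * normD f"
  unfolding normfrakD_def
proof (intro SUP_least)
  fix j k :: nat assume k: "k \<in> {0..j}"
  let ?A = "2 powr (real k - real j)" and ?c = "2 powr (real j / 2)"
  have "2 powr (real k - real j) \<le> 2 powr 0" using k by (intro powr_mono) auto
  then have A: "0 < ?A" "?A \<le> 1" by auto
  have "orlicz_norm ?A (\<lambda>x. ?c * frakD2 j k f x) \<le> 6 * orlicz_norm ?A (\<lambda>x. ?c * D2 j k f x)"
  proof (rule orlicz_norm_translates[OF A, where s = "1 / 2^k"])
    show "AE x in lborel. x \<in> {0..1} \<longrightarrow> \<bar>?c * frakD2 j k f x\<bar>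
        \<le> ?c * D2 j k f (x - 1 / 2^k) + ?c * D2 j k f x + ?c * D2 j k f (x + 1 / 2^k)"
      using AE_not_dyadic[of k]
    proof eventually_elim
      case (elim x)
      from frakD2_le_D2[OF f elim, of j] show ?case
        by (simp add: abs_mult frakD2_nonneg flip: distrib_left)
    qed
  qed (auto simp: D2_nonneg D2_outside)
  also have "\<dots> \<le> 6 * normD f"
    unfolding normD_def using k by (intro mult_left_mono SUP_upper2[of j] SUP_upper2[of k]) auto
  finally show "orlicz_norm ?A (\<lambda>x. ?c * frakD2 j k f x) \<le> 6 * normD f" .
qed

lemma normD_le:
  assumes f: "continuous_on {0..1} f"
  shows "normD f \<le> 6 * normfrakD f"
  unfolding normD_def
proof (intro SUP_least)
  fix j k :: nat assume k: "k \<in> {0..j}"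
  let ?A = "2 powr (real k - real j)" and ?c = "2 powr (real j / 2)"
  have "2 powr (real k - real j) \<le> 2 powr 0" using k by (intro powr_mono) auto
  then have A: "0 < ?A" "?A \<le> 1" by auto
  \<comment> \<open>Centred averages may be nonzero just outside [0,1], so they are cut off before
    translation.\<close>
  define g where "g x = indicator {0..1} x * frakD2 j k f x" for x
  have g: "0 \<le> g x" "x \<in> {0..1} \<Longrightarrow> g x = frakD2 j k f x" "x \<notin> {0..1} \<Longrightarrow> g x = 0" for x
    by (auto simp: g_def frakD2_nonneg)
  have [measurable]: "g \<in> borel_measurable borel"
    unfolding g_def using borel_measurable_continuous_on_indicator[OF _ continuous_on_frakD2[OF f]]
    by (simp add: mult.commute)
  have "orlicz_norm ?A (\<lambda>x. ?c * D2 j k f x) \<le> 6 * orlicz_norm ?A (\<lambda>x. ?c * g x)"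
  proof (rule orlicz_norm_translates[OF A, where s = "1 / 2^(k+1)"])
    show "AE x in lborel. x \<in> {0..1} \<longrightarrow> \<bar>?c * D2 j k f x\<bar>
        \<le> ?c * g (x - 1 / 2^(k+1)) + ?c * g x + ?c * g (x + 1 / 2^(k+1))"
      using AE_not_dyadic[of k]
    proof eventually_elim
      case (elim x)
      with D2_le_frakD2[OF f, of x k g j] g show ?case
        by (auto simp: abs_mult D2_nonneg simp flip: distrib_left)
    qed
  qed (auto simp: g)
  also have "orlicz_norm ?A (\<lambda>x. ?c * g x) = orlicz_norm ?A (\<lambda>x. ?c * frakD2 j k f x)"
    by (rule orlicz_norm_cong) (simp add: g)
  also have "6 * \<dots> \<le> 6 * normfrakD f"
    unfolding normfrakD_def using k by (intro mult_left_mono SUP_upper2[of j] SUP_upper2[of k]) auto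
  finally show "orlicz_norm ?A (\<lambda>x. ?c * D2 j k f x) \<le> 6 * normfrakD f" .
qed

section \<open>A bound by exponential block averages\<close>

text \<open>The substitution t = a + (m + u)d folds the n consecutive blocks onto [0,1]. For a fixed
  phase u the sampling points form an arithmetic progression, which later lets independence of
  increments apply.\<close>

lemma integral_split_blocks:
  fixes g :: "real \<Rightarrow> real"
  assumes g: "continuous_on UNIV g" and d: "0 < d"
  shows "integral {a..a + real n * d} g = d * integral {0..1} (\<lambda>u. \<Sum>m<n. g (a + (real m + u) * d))"
proof (induction n)
  case 0
  then show ?case by simp
next
  case (Suc n)
  have int: "g integrable_on {x..y}" for x y
    by (intro integrable_continuous_real continuous_on_subset[OF g]) auto
  let ?b = "a + real n * d"
  have "(g has_integral integral {?b..?b + d} g) (cbox ?b (?b + d))"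
    using int by (simp add: integrable_integral)
  from has_integral_affinity'[OF this d, of ?b]
  have "((\<lambda>u. g (a + (real n + u) * d)) has_integral (integral {?b..?b + d} g / d)) {0..1}"
    using d by (simp add: algebra_simps divide_inverse)
  then have last: "integral {?b..?b + d} g = d * integral {0..1} (\<lambda>u. g (a + (real n + u) * d))"
    using d by (simp add: integral_unique)
  have "integral {a..a + real (Suc n) * d} g = integral {a..?b} g + integral {?b..?b + d} g"
    using Henstock_Kurzweil_Integration.integral_combine[of a ?b "?b + d" g] int d
    by (simp add: algebra_simps)
  moreover have "integral {0..1} (\<lambda>u. (\<Sum>m<n. g (a + (real m + u) * d)) + g (a + (real n + u) * d))
      = integral {0..1} (\<lambda>u. \<Sum>m<n. g (a + (real m + u) * d)) + integral {0..1} (\<lambda>u. g (a + (real n + u) * d))"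
    by (intro Henstock_Kurzweil_Integration.integral_add integrable_continuous_real continuous_intros
        continuous_on_compose2[OF g]) auto
  ultimately show ?case using Suc.IH last by (simp add: algebra_simps)
qed

text \<open>Jensen's inequality by the tangent at x. Its slope is nonnegative because x >= 0, so it
  suffices that x is at most the mean of v.\<close>

lemma exp_square_integral_le:
  fixes v :: "real \<Rightarrow> real"
  assumes v: "continuous_on {0..1} v" and x: "0 \<le> x" "x \<le> integral {0..1} v" and c: "0 \<le> c"
  shows "exp (c * x\<^sup>2) \<le> integral {0..1} (\<lambda>u. exp (c * (v u)\<^sup>2))"
proof -
  define e where "e = exp (c * x\<^sup>2)"
  define b where "b = e * (2 * c * x)"
  have tangent: "(e - b * x) + b * y \<le> exp (c * y\<^sup>2)" for y
  proof -
    \<comment> \<open>The parabola lies above its tangent; then e^t >= 1 + t is applied to t = c(y^2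
      - x^2).\<close>
    have "1 + 2 * c * x * (y - x) \<le> 1 + (c * y\<^sup>2 - c * x\<^sup>2)"
      using mult_nonneg_nonneg[OF c zero_le_power2[of "y - x"]] by (simp add: power2_eq_square algebra_simps)
    also have "\<dots> \<le> exp (c * y\<^sup>2 - c * x\<^sup>2)" by (rule exp_ge_add_one_self)
    finally have "e * (1 + 2 * c * x * (y - x)) \<le> e * exp (c * y\<^sup>2 - c * x\<^sup>2)"
      by (rule mult_left_mono) (simp add: e_def)
    also have "\<dots> = exp (c * y\<^sup>2)" unfolding e_def exp_add[symmetric] by simp
    finally show ?thesis by (simp add: b_def algebra_simps)
  qed
  have "0 \<le> b * (integral {0..1} v - x)" using x c by (simp add: b_def e_def)
  then have "e \<le> (e - b * x) + b * integral {0..1} v"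
    by (simp add: algebra_simps)
  also have "\<dots> = integral {0..1} (\<lambda>u::real. e - b * x) + integral {0..1} (\<lambda>u. b * v u)"
    by simp
  also have "\<dots> = integral {0..1} (\<lambda>u. (e - b * x) + b * v u)"
    by (intro Henstock_Kurzweil_Integration.integral_add[symmetric] integrable_continuous_real continuous_intros v)
  also have "\<dots> \<le> integral {0..1} (\<lambda>u. exp (c * (v u)\<^sup>2))"
    by (intro integral_le integrable_continuous_real continuous_intros v tangent)
  finally show ?thesis by (simp add: e_def)
qed

text \<open>One exponential for both branches makes Jensen's inequality applicable, at the price of
  1/2, half of the budget in the Luxemburg norm. If v^2 > 1/2 the exponent is nonnegative, which
  settles v <= 1; for v > 1 use 8v^2 - 4 >= v^2 - 1. At v = X/8 and A = 1/n the exponent is nX^2/8 -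
  4n.\<close>

lemma Phi2_le_exp:
  assumes "0 < A" "A \<le> 1"
  shows "Phi2 A v \<le> 1/2 + exp ((8 * v\<^sup>2 - 4) / A)"
proof -
  have "v\<^sup>2 \<le> 1/2 + exp ((8 * v\<^sup>2 - 4) / A)" if "0 < v" "v \<le> 1"
  proof (cases "v\<^sup>2 \<le> 1/2")
    case True
    then show ?thesis by (simp add: add_increasing2)
  next
    case False
    then have "1 \<le> exp ((8 * v\<^sup>2 - 4) / A)" using assms by simp
    moreover have "v\<^sup>2 \<le> 1" using that by (simp add: power_le_one)
    ultimately show ?thesis by linarith
  qed
  moreover have "exp ((v\<^sup>2 - 1) / A) \<le> exp ((8 * v\<^sup>2 - 4) / A)" if "1 < v"
  proof -
    have "1 \<le> v\<^sup>2" using that by simp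
    then show ?thesis using assms by (auto intro!: divide_right_mono)
  qed
  ultimately show ?thesis by (auto simp: Phi2_def intro: add_increasing add_nonneg_nonneg)
qed

text \<open>Along a Wiener path the half step increments below have variance $2^{-j-1}$, so the exponent in
  \<open>exp_incr\<close> is $\eta^2/8$ for a standard normal $\eta$. The block with index \<open>l\<close> consists of the
  $2\cdot 2^{j-k}$ half steps in the dyadic interval \<open>dyad k l\<close>, translated by $u2^{-j}$.\<close>

definition half_incr :: "(real \<Rightarrow> real) \<Rightarrow> nat \<Rightarrow> nat \<Rightarrow> real \<Rightarrow> real" where
  "half_incr f j p u = f ((u + real (Suc p) / 2) / 2^j) - f ((u + real p / 2) / 2^j)"

definition exp_incr :: "(real \<Rightarrow> real) \<Rightarrow> nat \<Rightarrow> nat \<Rightarrow> real \<Rightarrow> real" where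
  "exp_incr f j p u = exp (2^j * (half_incr f j p u)\<^sup>2 / 4)"

definition exp_block :: "(real \<Rightarrow> real) \<Rightarrow> nat \<Rightarrow> nat \<Rightarrow> nat \<Rightarrow> real \<Rightarrow> real" where
  "exp_block f j k l u = exp (- 4 * 2^(j-k)) * (\<Prod>p<2*2^(j-k). exp_incr f j (2*2^(j-k)*l + p) u)"

definition exp_mean :: "(real \<Rightarrow> real) \<Rightarrow> nat \<Rightarrow> nat \<Rightarrow> real \<Rightarrow> real" where
  "exp_mean f j k u = (\<Sum>l<2^k. exp_block f j k l u) / 2^k"

text \<open>Continuity is assumed on the whole line because the translated blocks reach 1 + u 2^-j,
  beyond the right end of [0,1].\<close>

lemma continuous_exp_block [continuous_intros]:
  assumes f: "continuous_on UNIV f"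
  shows "continuous_on S (exp_block f j k l)"
  unfolding exp_block_def exp_incr_def half_incr_def
  by (intro continuous_intros continuous_on_compose2[OF f]) auto

lemma continuous_exp_mean [continuous_intros]:
  assumes f: "continuous_on UNIV f"
  shows "continuous_on S (exp_mean f j k)"
  unfolding exp_mean_def by (intro continuous_intros f) auto

lemma sum_lessThan_double: "(\<Sum>p<2*n. g p) = (\<Sum>m<n. g (2*m) + g (2*m+1))" for g :: "nat \<Rightarrow> real"
  by (induction n) (auto simp: add.assoc)

text \<open>Cauchy-Schwarz bounds the square of the mean by the mean of the squares. A second
  difference is the difference of two adjacent half step increments, and (a - b)^2 <= 2a^2 + 2b^2
  separates them.\<close>

lemma square_mean_le_half_incr:
  fixes n :: nat
  assumes "0 < n"
  shows "n * ((\<Sum>m<n. 2 powr (real j / 2) * \<bar>half_incr f j (2*(i+m)+1) u - half_incr f j (2*(i+m)) u\<bar>) / n)\<^sup>2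
    \<le> (\<Sum>p<2*n. 2 * 2^j * (half_incr f j (2*i+p) u)\<^sup>2)"
proof -
  let ?z = "\<lambda>m. 2 powr (real j / 2) * \<bar>half_incr f j (2*(i+m)+1) u - half_incr f j (2*(i+m)) u\<bar>"
  have sq: "(2 powr (real j / 2))\<^sup>2 = (2::real)^j" by (simp add: power2_eq_square powr_realpow flip: powr_add)
  have "n * ((\<Sum>m<n. ?z m) / n)\<^sup>2 = (\<Sum>m<n. ?z m)\<^sup>2 / n"
    using assms by (simp add: power2_eq_square)
  also have "\<dots> \<le> (\<Sum>m<n. (?z m)\<^sup>2)"
    using sum_squared_le_sum_of_squares[of ?z "{..<n}"] assms by (simp add: field_simps)
  also have "\<dots> \<le> (\<Sum>m<n. 2 * 2^j * (half_incr f j (2*i+2*m) u)\<^sup>2 + 2 * 2^j * (half_incr f j (2*i+(2*m+1)) u)\<^sup>2)"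
  proof (rule sum_mono)
    fix m
    have "(a - b)\<^sup>2 \<le> 2 * b\<^sup>2 + 2 * a\<^sup>2" for a b :: real
      using zero_le_power2[of "a + b"] by (simp add: power2_eq_square algebra_simps)
    from mult_left_mono[OF this, of "2^j" "half_incr f j (2*(i+m)+1) u" "half_incr f j (2*(i+m)) u"]
    show "(?z m)\<^sup>2 \<le> 2 * 2^j * (half_incr f j (2*i+2*m) u)\<^sup>2 + 2 * 2^j * (half_incr f j (2*i+(2*m+1)) u)\<^sup>2"
      unfolding power_mult_distrib sq power2_abs by (simp add: algebra_simps)
  qed
  also have "\<dots> = (\<Sum>p<2*n. 2 * 2^j * (half_incr f j (2*i+p) u)\<^sup>2)"
    by (rule sum_lessThan_double[symmetric])
  finally show ?thesis .
qed

text \<open>The factor 1/8 turns the coefficient \<open>2 * 2^j\<close> of the quadratic bound into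
  \<open>2^j / 4\<close>, that of \<open>exp_incr\<close>; the exponential of the sum is then the
  product over the block.\<close>

lemma exp_square_mean_le_exp_block:
  assumes n: "n = 2^(j-k)"
  shows "exp (real n / 8 * ((\<Sum>m<n. 2 powr (real j / 2) * \<bar>half_incr f j (2*(n*l+m)+1) u - half_incr f j (2*(n*l+m)) u\<bar>) / n)\<^sup>2)
    \<le> exp (4 * real n) * exp_block f j k l u" (is "exp (_ * ?v\<^sup>2) \<le> _")
proof -
  have n': "(2::real)^(j-k) = real n" "(2::nat)^(j-k) = n" by (simp_all add: n)
  have "real n * ?v\<^sup>2 \<le> (\<Sum>p<2*n. 2 * 2^j * (half_incr f j (2*(n*l)+p) u)\<^sup>2)"
    by (rule square_mean_le_half_incr) (simp add: n)
  then have "real n / 8 * ?v\<^sup>2 \<le> (\<Sum>p<2*n. 2^j * (half_incr f j (2*n*l+p) u)\<^sup>2 / 4)"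
    by (simp add: sum_distrib_left[symmetric] sum_divide_distrib[symmetric] mult.assoc)
  then have "exp (real n / 8 * ?v\<^sup>2) \<le> exp (\<Sum>p<2*n. 2^j * (half_incr f j (2*n*l+p) u)\<^sup>2 / 4)"
    by simp
  also have "\<dots> = exp (4 * real n) * exp_block f j k l u"
    unfolding exp_block_def exp_incr_def n' by (simp add: exp_sum exp_minus)
  finally show ?thesis .
qed

lemma osc_integral_le_half_incr:
  fixes f :: "real \<Rightarrow> real"
  assumes f: "continuous_on UNIV f" and "k \<le> j" and n: "n = 2^(j-k)"
  shows "2^k * osc_integral j f (real l / 2^k) ((real l + 1) / 2^k)
    \<le> integral {0..1} (\<lambda>u. (\<Sum>m<n. \<bar>half_incr f j (2*(n*l+m)+1) u - half_incr f j (2*(n*l+m)) u\<bar>) / n)"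
proof -
  let ?h = "1 / 2^(j+1) :: real"
  \<comment> \<open>The untruncated second difference is continuous and dominates the truncated one,
    so blocks at the boundary fold like all others.\<close>
  define w where "w t = \<bar>f (t + 2 * ?h) - 2 * f (t + ?h) + f t\<bar>" for t
  have w: "continuous_on S w" for S
    unfolding w_def by (intro continuous_intros continuous_on_compose2[OF f]) auto
  have kj: "2^j = 2^k * real n" using \<open>k \<le> j\<close> by (simp add: n flip: power_add)
  have "0 < n" by (simp add: n)
  have "osc_integral j f (real l / 2^k) ((real l + 1) / 2^k) \<le> integral {real l / 2^k..(real l + 1) / 2^k} w"
    unfolding osc_integral_def using f w
    by (intro integral_le integrable_osc integrable_continuous_real) (auto simp: Delta2_def w_def intro: continuous_on_subset)
  also have "{real l / 2^k..(real l + 1) / 2^k} = {real l / 2^k..real l / 2^k + real n * (1 / 2^j)}"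
    using \<open>0 < n\<close> by (simp add: kj field_simps)
  also have "integral \<dots> w = 1 / 2^j * integral {0..1} (\<lambda>u. \<Sum>m<n. w (real l / 2^k + (real m + u) * (1 / 2^j)))"
    by (rule integral_split_blocks[OF w]) simp
  also have "(\<lambda>u. \<Sum>m<n. w (real l / 2^k + (real m + u) * (1 / 2^j)))
      = (\<lambda>u. \<Sum>m<n. \<bar>half_incr f j (2*(n*l+m)+1) u - half_incr f j (2*(n*l+m)) u\<bar>)"
  proof (intro ext sum.cong refl)
    fix u m
    define t where "t = real l / 2^k + (real m + u) * (1 / 2^j)"
    \<comment> \<open>Since 2^j = 2^k n, the three points of the second difference are consecutive
      half step nodes, starting with number 2(nl + m).\<close>
    have "t = (u + real (2*(n*l+m)) / 2) / 2^j" "t + ?h = (u + real (Suc (2*(n*l+m))) / 2) / 2^j"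
      "t + 2 * ?h = (u + real (Suc (Suc (2*(n*l+m)))) / 2) / 2^j"
      using \<open>0 < n\<close> by (auto simp: t_def kj field_simps)
    then have "w t = \<bar>half_incr f j (2*(n*l+m)+1) u - half_incr f j (2*(n*l+m)) u\<bar>"
      by (simp add: w_def half_incr_def)
    then show "w (real l / 2^k + (real m + u) * (1 / 2^j))
        = \<bar>half_incr f j (2*(n*l+m)+1) u - half_incr f j (2*(n*l+m)) u\<bar>"
      by (simp add: t_def)
  qed
  finally have "2^k * osc_integral j f (real l / 2^k) ((real l + 1) / 2^k) \<le>
    2^k * (1 / 2^j * integral {0..1} (\<lambda>u. \<Sum>m<n. \<bar>half_incr f j (2*(n*l+m)+1) u - half_incr f j (2*(n*l+m)) u\<bar>))"
    by (rule mult_left_mono) simp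
  then show ?thesis using \<open>0 < n\<close> by (simp add: kj)
qed

lemma Phi2_D2_le:
  assumes f: "continuous_on UNIV f" and "k \<le> j"
  shows "Phi2 (2 powr (real k - real j))
      (2 powr (real j / 2) * (2^k * osc_integral j f (real l / 2^k) ((real l + 1) / 2^k)) / 8)
    \<le> 1/2 + integral {0..1} (exp_block f j k l)" (is "Phi2 ?A (?X / 8) \<le> _")
proof -
  define n :: nat where "n = 2^(j-k)"
  let ?v = "\<lambda>u. (\<Sum>m<n. 2 powr (real j / 2) * \<bar>half_incr f j (2*(n*l+m)+1) u - half_incr f j (2*(n*l+m)) u\<bar>) / n"
  have A: "?A = 1 / n" using \<open>k \<le> j\<close>
    by (simp add: n_def powr_diff powr_realpow power_diff_conv_inverse field_simps)
  have n: "1 \<le> n" by (simp add: n_def)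
  have half_incr: "continuous_on {0..1} (half_incr f j p)" for p
    unfolding half_incr_def by (intro continuous_intros continuous_on_compose2[OF f]) auto
  have v: "continuous_on {0..1} ?v"
    by (intro continuous_intros half_incr) (use n in auto)
  have "?X \<le> 2 powr (real j / 2) * integral {0..1} (\<lambda>u. (\<Sum>m<n. \<bar>half_incr f j (2*(n*l+m)+1) u - half_incr f j (2*(n*l+m)) u\<bar>) / n)"
    by (intro mult_left_mono osc_integral_le_half_incr f \<open>k \<le> j\<close> n_def) simp
  also have "\<dots> = integral {0..1} ?v"
    by (subst Henstock_Kurzweil_Integration.integral_mult_right[symmetric]) (simp add: sum_distrib_left)
  finally have X: "?X \<le> integral {0..1} ?v" .
  have "exp (real n / 8 * ?X\<^sup>2) \<le> integral {0..1} (\<lambda>u. exp (real n / 8 * (?v u)\<^sup>2))"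
    by (rule exp_square_integral_le[OF v _ X]) (auto simp: osc_integral_nonneg)
  also have "\<dots> \<le> integral {0..1} (\<lambda>u. exp (4 * real n) * exp_block f j k l u)"
    using n by (intro integral_le integrable_continuous_real continuous_intros f half_incr
        exp_square_mean_le_exp_block n_def) auto
  also have "\<dots> = exp (4 * n) * integral {0..1} (exp_block f j k l)" by simp
  finally have "exp (real n / 8 * ?X\<^sup>2) / exp (4 * n) \<le> integral {0..1} (exp_block f j k l)"
    by (simp add: field_simps)
  moreover have "(8 * (?X / 8)\<^sup>2 - 4) / ?A = real n / 8 * ?X\<^sup>2 - 4 * n"
    unfolding A by (simp add: power_divide field_simps)
  then have "Phi2 ?A (?X / 8) \<le> 1/2 + exp (real n / 8 * ?X\<^sup>2 - 4 * n)"
    using Phi2_le_exp[of ?A "?X / 8"] n by (simp add: A)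
  ultimately show ?thesis by (simp add: exp_diff)
qed

text \<open>Up to a null set \<open>D2\<close> is constant on each dyadic interval of length 2^-k,
  so the modular at scale 8 is at most 1/2 plus the mean over l of the integrated blocks. The
  hypothesis bounds this by 1/2 + 1/2.\<close>

lemma orlicz_norm_D2_le:
  assumes f: "continuous_on UNIV f" and "k \<le> j"
    and mean: "integral {0..1} (exp_mean f j k) \<le> 1/2"
  shows "orlicz_norm (2 powr (real k - real j)) (\<lambda>x. 2 powr (real j / 2) * D2 j k f x) \<le> 8"
proof -
  let ?A = "2 powr (real k - real j)"
  define Y where "Y l = 1/2 + integral {0..1} (exp_block f j k l)" for l
  have block_nonneg: "0 \<le> exp_block f j k l u" for l u
    unfolding exp_block_def exp_incr_def by (intro mult_nonneg_nonneg prod_nonneg) auto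
  have Y: "0 \<le> Y l" for l unfolding Y_def using f
    by (intro add_nonneg_nonneg integral_nonneg integrable_continuous_real continuous_intros block_nonneg) auto
  have "(\<integral>\<^sup>+ x. ennreal (Phi2 ?A (\<bar>2 powr (real j / 2) * D2 j k f x\<bar> / 8)) * indicator {0..1} x \<partial>lborel)
      \<le> (\<integral>\<^sup>+ x. (\<Sum>l<2^k. ennreal (Y l) * indicator (dyad k l) x) \<partial>lborel)"
  proof (intro nn_integral_mono_AE, use AE_not_dyadic[of k] in eventually_elim)
    fix x :: real assume x: "x * 2^k \<notin> \<int>"
    show "ennreal (Phi2 ?A (\<bar>2 powr (real j / 2) * D2 j k f x\<bar> / 8)) * indicator {0..1} x
        \<le> (\<Sum>l<2^k. ennreal (Y l) * indicator (dyad k l) x)"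
    proof (cases "x \<in> {0..1}")
      case True
      define l where "l = nat \<lfloor>x * 2^k\<rfloor>"
      have l: "\<lfloor>x * 2^k\<rfloor> = int l" using True by (simp add: l_def)
      have "(2::real)^k \<in> \<int>" by (intro Ints_power) simp
      then have "x * 2^k \<noteq> 2^k" using x by auto
      moreover have "x * 2^k \<le> 2^k" using True by simp
      ultimately have "x * 2^k < 2^k" by linarith
      then have "int l < 2^k" unfolding l[symmetric] by (simp add: floor_less_iff)
      then have "l < 2^k" by (metis of_nat_less_iff of_nat_numeral of_nat_power)
      have "Phi2 ?A (\<bar>2 powr (real j / 2) * D2 j k f x\<bar> / 8) \<le> Y l"
        using Phi2_D2_le[OF f \<open>k \<le> j\<close>, of l]
        by (simp add: Y_def D2_floor[OF x] l abs_mult osc_integral_nonneg)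
      then have "ennreal (Phi2 ?A (\<bar>2 powr (real j / 2) * D2 j k f x\<bar> / 8)) * indicator {0..1} x
          \<le> ennreal (Y l) * indicator (dyad k l) x"
        using True l by (simp add: mem_dyad_iff_floor[OF x] ennreal_leI)
      also have "\<dots> \<le> (\<Sum>l<2^k. ennreal (Y l) * indicator (dyad k l) x)"
        using \<open>l < 2^k\<close> by (intro member_le_sum[where f = "\<lambda>l. ennreal (Y l) * indicator (dyad k l) x"]) auto
      finally show ?thesis .
    qed simp
  qed
  also have "\<dots> = (\<Sum>l<2^k. ennreal (Y l) * emeasure lborel (dyad k l))"
    by (subst nn_integral_sum) (auto simp: dyad_def nn_integral_cmult_indicator)
  also have "\<dots> = (\<Sum>l<2^k. ennreal (Y l / 2^k))"
  proof (intro sum.cong refl)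
    fix l
    have "emeasure lborel (dyad k l) = ennreal (1 / 2^k)"
      by (simp add: dyad_def divide_right_mono flip: diff_divide_distrib)
    then show "ennreal (Y l) * emeasure lborel (dyad k l) = ennreal (Y l / 2^k)"
      using Y by (simp flip: ennreal_mult)
  qed
  also have "\<dots> = ennreal ((\<Sum>l<2^k. Y l) / 2^k)"
    using Y by (simp add: sum_divide_distrib)
  also have "(\<Sum>l<2^k. Y l) / 2^k = 1/2 + (\<Sum>l<2^k. integral {0..1} (exp_block f j k l)) / 2^k"
    by (simp add: Y_def sum.distrib add_divide_distrib)
  also have "(\<Sum>l<2^k. integral {0..1} (exp_block f j k l)) / 2^k = integral {0..1} (exp_mean f j k)"
    unfolding exp_mean_def[abs_def] using f
    by (simp add: Henstock_Kurzweil_Integration.integral_sum integrable_continuous_real continuous_intros)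
  also have "ennreal (1/2 + integral {0..1} (exp_mean f j k)) \<le> ennreal 1"
    using mean by (intro ennreal_leI) simp
  finally have "orlicz_norm ?A (\<lambda>x. 2 powr (real j / 2) * D2 j k f x) \<le> ennreal 8"
    by (intro orlicz_norm_le) auto
  then show ?thesis by simp
qed

section \<open>Finiteness of the norm from summable variances along one path\<close>

definition exp_variance :: "real \<Rightarrow> (real \<Rightarrow> real) \<Rightarrow> nat \<Rightarrow> nat \<Rightarrow> ennreal" where
  "exp_variance \<mu> f j k = (\<integral>\<^sup>+ u. ennreal ((exp_mean f j k u - \<mu>)\<^sup>2) * indicator {0..1} u \<partial>lborel)"

text \<open>The threshold 1/16 gives 2/16 + 3/8 = 1/2, the bound required by
  \<open>orlicz_norm_D2_le\<close>.\<close>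

lemma integral_exp_mean_le:
  assumes f: "continuous_on UNIV f" and \<mu>: "\<mu> \<le> 1/4" and V: "exp_variance \<mu> f j k \<le> ennreal (1/16)"
  shows "integral {0..1} (exp_mean f j k) \<le> 1/2"
proof -
  let ?V = "integral {0..1} (\<lambda>u. (exp_mean f j k u - \<mu>)\<^sup>2)"
  have int: "(\<lambda>u. (exp_mean f j k u - \<mu>)\<^sup>2) integrable_on {0..1}"
    by (intro integrable_continuous_real continuous_intros f)
  then have "exp_variance \<mu> f j k = ennreal ?V"
    unfolding exp_variance_def
    by (intro nn_integral_has_integral_lebesgue' integrable_integral) auto
  with V have "?V \<le> 1/16" by (simp add: ennreal_le_iff)
  have "integral {0..1} (exp_mean f j k) \<le> integral {0..1} (\<lambda>u. 2 * (exp_mean f j k u - \<mu>)\<^sup>2 + 3/8)"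
  proof (intro integral_le integrable_continuous_real continuous_intros f)
    \<comment> \<open>$x \le 2x^2 + 1/8$ avoids the square root of the Cauchy-Schwarz inequality\<close>
    fix u
    have "0 \<le> (exp_mean f j k u - \<mu> - 1/4)\<^sup>2" by simp
    then show "exp_mean f j k u \<le> 2 * (exp_mean f j k u - \<mu>)\<^sup>2 + 3/8"
      using \<mu> by (simp add: power2_eq_square algebra_simps)
  qed
  also have "\<dots> = 2 * ?V + 3/8"
    using int by (subst Henstock_Kurzweil_Integration.integral_add) (auto intro: integrable_on_mult_right)
  finally show ?thesis using \<open>?V \<le> 1/16\<close> by simp
qed

text \<open>For fixed j and k, \<open>D2\<close> is a finite combination of indicators and hence
  bounded. This covers the small j that the variance bound does not reach.\<close>

lemma orlicz_norm_D2_finite: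
  "orlicz_norm (2 powr (real k - real j)) (\<lambda>x. 2 powr (real j / 2) * D2 j k f x) < \<infinity>"
proof (rule orlicz_norm_bounded)
  let ?X = "\<lambda>l. 2^k * integral (dyad k l) (\<lambda>t. \<bar>Delta2 f (1 / 2^(j+1)) t\<bar>)"
  fix x :: real
  have "\<bar>D2 j k f x\<bar> \<le> (\<Sum>l<2^k. \<bar>indicator (dyad k l) x * ?X l\<bar>)"
    unfolding D2_def by (rule sum_abs)
  also have "\<dots> \<le> (\<Sum>l<2^k. \<bar>?X l\<bar>)" by (intro sum_mono) (auto simp: indicator_def)
  finally show "\<bar>2 powr (real j / 2) * D2 j k f x\<bar> \<le> 2 powr (real j / 2) * (\<Sum>l<2^k. \<bar>?X l\<bar>)"
    by (simp add: abs_mult)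
qed simp

text \<open>Summability makes the variances at level j smaller than 1/16 from some J on, where the
  norms are at most 8; only finitely many pairs precede J.\<close>

lemma normD_finite:
  fixes \<mu> :: "nat \<Rightarrow> nat \<Rightarrow> real"
  assumes f: "continuous_on UNIV f" and \<mu>: "\<And>j k. k \<le> j \<Longrightarrow> \<mu> j k \<le> 1/4"
    and V: "(\<Sum>j. \<Sum>k\<le>j. exp_variance (\<mu> j k) f j k) < \<infinity>"
  shows "normD f < \<infinity>"
proof -
  let ?N = "\<lambda>j k. orlicz_norm (2 powr (real k - real j)) (\<lambda>x. 2 powr (real j / 2) * D2 j k f x)"
  define v where "v j = (\<Sum>k\<le>j. exp_variance (\<mu> j k) f j k)" for j
  have suminf_v: "(\<Sum>j. v j) \<noteq> \<top>" using V by (simp add: v_def)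
  have v_less: "v j < \<top>" for j
    by (rule ennreal_suminf_lessD) (rule suminf_v[unfolded less_top])
  define r where "r j = enn2real (v j)" for j
  have r: "\<And>j. 0 \<le> r j" "v = (\<lambda>j. ennreal (r j))"
    using v_less by (auto simp: r_def)
  then have "summable r" using suminf_v unfolding r(2) by (intro summable_suminf_not_top r(1))
  then have "v \<longlonglongrightarrow> ennreal 0"
    unfolding r(2) by (intro tendsto_ennrealI summable_LIMSEQ_zero)
  then have "eventually (\<lambda>j. v j < ennreal (1/16)) sequentially"
    by (rule order_tendstoD) (simp add: ennreal_less_iff)
  then obtain J where J: "\<And>j. J \<le> j \<Longrightarrow> v j < ennreal (1/16)"
    by (auto simp: eventually_sequentially)
  \<comment> \<open>The range j <= J, rather than j < J, keeps the set nonempty, as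
    \<open>Max\<close> demands.\<close>
  define B where "B = max 8 (Max ((\<lambda>(j, k). ?N j k) ` (SIGMA j:{..J}. {..j})))"
  have "?N j k \<le> B" if "k \<le> j" for j k
  proof (cases "J \<le> j")
    case True
    have "exp_variance (\<mu> j k) f j k \<le> v j"
      unfolding v_def using that by (intro member_le_sum) auto
    with J[OF True] have "exp_variance (\<mu> j k) f j k \<le> ennreal (1/16)" by simp
    then have "?N j k \<le> 8"
      by (intro orlicz_norm_D2_le f that integral_exp_mean_le[OF f \<mu>[OF that]])
    then show ?thesis by (simp add: B_def le_max_iff_disj)
  next
    case False
    then have "?N j k \<le> Max ((\<lambda>(j, k). ?N j k) ` (SIGMA j:{..J}. {..j}))"
      using that by (intro Max_ge) auto
    then show ?thesis by (simp add: B_def le_max_iff_disj)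
  qed
  then have "normD f \<le> B" unfolding normD_def by (intro SUP_least) auto
  also have "Max ((\<lambda>(j, k). ?N j k) ` (SIGMA j:{..J}. {..j})) < \<infinity>"
    by (subst Max_less_iff) (auto simp: orlicz_norm_D2_finite[unfolded infinity_ennreal_def])
  then have "B < \<infinity>" by (simp add: B_def)
  finally show ?thesis .
qed

section \<open>Second moments for the Wiener process\<close>

text \<open>Completing the square: the weight turns the density with deviation s into 1/r times the
  density with deviation s/r, where r^2 = 1 - 2a > 0.\<close>

lemma nn_integral_exp_square_normal:
  assumes X: "distributed M lborel X (\<lambda>x. ennreal (normal_density 0 s x))"
    and s: "0 < s" and a: "a < 1/2"
  shows "(\<integral>\<^sup>+ \<omega>. ennreal (exp (a * (X \<omega> / s)\<^sup>2)) \<partial>M) = ennreal (1 / sqrt (1 - 2 * a))"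
proof -
  define r where "r = sqrt (1 - 2 * a)"
  have r: "0 < r" "r\<^sup>2 = 1 - 2 * a" using a by (auto simp: r_def)
  have density: "ennreal (normal_density 0 s x) * ennreal (exp (a * (x / s)\<^sup>2))
      = ennreal (1 / r) * ennreal (normal_density 0 (s / r) x)" for x
  proof -
    have nd: "normal_density 0 t x = 1 / (sqrt (2 * pi) * t) * exp (- x\<^sup>2 / (2 * t\<^sup>2))" if "0 < t" for t
      using that by (simp add: normal_density_def real_sqrt_mult)
    have "normal_density 0 s x * exp (a * (x / s)\<^sup>2)
        = 1 / (sqrt (2 * pi) * s) * (exp (- x\<^sup>2 / (2 * s\<^sup>2)) * exp (a * (x / s)\<^sup>2))"
      unfolding nd[OF s] by simp
    also have "exp (- x\<^sup>2 / (2 * s\<^sup>2)) * exp (a * (x / s)\<^sup>2) = exp (- x\<^sup>2 / (2 * (s / r)\<^sup>2))"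
      unfolding exp_add[symmetric] power_divide r(2) using s by (simp add: field_simps)
    also have "1 / (sqrt (2 * pi) * s) * \<dots> = 1 / r * normal_density 0 (s / r) x"
      using r(1) s by (subst nd) auto
    finally have "normal_density 0 s x * exp (a * (x / s)\<^sup>2) = 1 / r * normal_density 0 (s / r) x" .
    then show ?thesis using r by (simp flip: ennreal_mult)
  qed
  have "(\<integral>\<^sup>+ \<omega>. ennreal (exp (a * (X \<omega> / s)\<^sup>2)) \<partial>M)
      = (\<integral>\<^sup>+ x. ennreal (normal_density 0 s x) * ennreal (exp (a * (x / s)\<^sup>2)) \<partial>lborel)"
    by (rule distributed_nn_integral[OF X, symmetric]) measurable
  also have "\<dots> = ennreal (1 / r) * (\<integral>\<^sup>+ x. ennreal (normal_density 0 (s / r) x) \<partial>lborel)"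
    unfolding density by (rule nn_integral_cmult) measurable
  also have "(\<integral>\<^sup>+ x. ennreal (normal_density 0 (s / r) x) \<partial>lborel) = 1"
    using r s by (subst nn_integral_eq_integral) (auto intro: integrable_normal_density)
  finally show ?thesis by (simp add: r_def)
qed

text \<open>Distinct blocks share no index, so their products are uncorrelated and only the L
  diagonal terms of the variance survive. Mixed moments come from the product over the union of two
  blocks, so independence of the single factors suffices.\<close>

lemma (in prob_space) nn_variance_mean_of_block_products:
  fixes E :: "nat \<Rightarrow> 'a \<Rightarrow> real" and c \<kappa> \<kappa>' :: real
  assumes indep: "indep_vars (\<lambda>_. borel) E {..<L * K}"
    and E: "\<And>p. p < L * K \<Longrightarrow> has_bochner_integral M (E p) \<kappa>"
    and E2: "\<And>p. p < L * K \<Longrightarrow> has_bochner_integral M (\<lambda>\<omega>. (E p \<omega>)\<^sup>2) \<kappa>'"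
    and "0 < L"
  shows "(\<integral>\<^sup>+ \<omega>. ennreal (((\<Sum>l<L. c * (\<Prod>p<K. E (K * l + p) \<omega>)) / L - c * \<kappa> ^ K)\<^sup>2) \<partial>M)
    \<le> ennreal (c\<^sup>2 * \<kappa>' ^ K / L)"
proof -
  define B where "B l = {K * l..<K * l + K}" for l
  define Y where "Y l \<omega> = c * (\<Prod>p\<in>B l. E p \<omega>)" for l \<omega>
  define m where "m = c * \<kappa> ^ K"
  have B: "finite (B l)" "card (B l) = K" for l by (auto simp: B_def)
  have B_sub: "B l \<subseteq> {..<L * K}" if "l < L" for l
  proof -
    have "Suc l * K \<le> L * K" using that by (intro mult_right_mono) auto
    then show ?thesis by (auto simp: B_def algebra_simps)
  qed
  have B_disj: "B l \<inter> B l' = {}" if "l \<noteq> l'" for l l'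
  proof -
    have "p div K = l" if "p \<in> B l" for p l
      using that by (intro div_nat_eqI) (auto simp: B_def algebra_simps)
    then show ?thesis using that by auto
  qed
  have prod: "has_bochner_integral M (\<lambda>\<omega>. \<Prod>p\<in>I. E p \<omega>) (\<kappa> ^ card I)" if "I \<subseteq> {..<L * K}" for I
  proof -
    have fin: "finite I" using that finite_subset by blast
    have ind: "indep_vars (\<lambda>_. borel) E I" by (rule indep_vars_subset[OF indep that])
    have int: "integrable M (E p)" "integral\<^sup>L M (E p) = \<kappa>" if "p \<in> I" for p
      using E[of p] that \<open>I \<subseteq> _\<close> by (auto simp: has_bochner_integral_iff)
    show ?thesis
      using indep_vars_integrable[OF fin ind int(1)] indep_vars_lebesgue_integral[OF fin ind int(1)] int(2)
      by (simp add: has_bochner_integral_iff)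
  qed
  have prod2: "has_bochner_integral M (\<lambda>\<omega>. \<Prod>p\<in>I. (E p \<omega>)\<^sup>2) (\<kappa>' ^ card I)" if "I \<subseteq> {..<L * K}" for I
  proof -
    have fin: "finite I" using that finite_subset by blast
    have ind: "indep_vars (\<lambda>_. borel) (\<lambda>p \<omega>. (E p \<omega>)\<^sup>2) I"
      by (rule indep_vars_compose2[OF indep_vars_subset[OF indep that]]) measurable
    have int: "integrable M (\<lambda>\<omega>. (E p \<omega>)\<^sup>2)" "integral\<^sup>L M (\<lambda>\<omega>. (E p \<omega>)\<^sup>2) = \<kappa>'" if "p \<in> I" for p
      using E2[of p] that \<open>I \<subseteq> _\<close> by (auto simp: has_bochner_integral_iff)
    show ?thesis
      using indep_vars_integrable[OF fin ind int(1)] indep_vars_lebesgue_integral[OF fin ind int(1)] int(2)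
      by (simp add: has_bochner_integral_iff)
  qed
  have Y: "has_bochner_integral M (Y l) m" if "l < L" for l
    using has_bochner_integral_mult_right[OF prod[OF B_sub[OF that]], of c] by (simp add: Y_def[abs_def] m_def B)
  have YY: "has_bochner_integral M (\<lambda>\<omega>. Y l \<omega> * Y l' \<omega>) (if l = l' then c\<^sup>2 * \<kappa>' ^ K else m\<^sup>2)"
    if "l < L" "l' < L" for l l'
  proof (cases "l = l'")
    case True
    then show ?thesis
      using has_bochner_integral_mult_right[OF prod2[OF B_sub[OF that(1)]], of "c\<^sup>2"]
      by (simp add: Y_def B power2_eq_square prod.distrib mult_ac)
  next
    case False
    have "B l \<union> B l' \<subseteq> {..<L * K}" using B_sub that by auto
    moreover have "card (B l \<union> B l') = K + K" using B_disj[OF False] by (simp add: card_Un_disjoint B)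
    ultimately have "has_bochner_integral M (\<lambda>\<omega>. c\<^sup>2 * (\<Prod>p\<in>B l \<union> B l'. E p \<omega>)) (c\<^sup>2 * \<kappa> ^ (K + K))"
      using has_bochner_integral_mult_right[OF prod[of "B l \<union> B l'"], of "c\<^sup>2"] by simp
    moreover have "c\<^sup>2 * (\<Prod>p\<in>B l \<union> B l'. E p \<omega>) = Y l \<omega> * Y l' \<omega>" for \<omega>
      using B_disj[OF False] by (simp add: prod.union_disjoint B Y_def power2_eq_square mult_ac)
    ultimately show ?thesis using False by (simp add: m_def power2_eq_square power_add mult_ac)
  qed
  have cov: "has_bochner_integral M (\<lambda>\<omega>. (Y l \<omega> - m) * (Y l' \<omega> - m)) (if l = l' then c\<^sup>2 * \<kappa>' ^ K - m\<^sup>2 else 0)"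
    if "l < L" "l' < L" for l l'
  proof -
    have "has_bochner_integral M (\<lambda>\<omega>. Y l \<omega> * Y l' \<omega> - m * Y l \<omega> - m * Y l' \<omega> + m\<^sup>2)
        ((if l = l' then c\<^sup>2 * \<kappa>' ^ K else m\<^sup>2) - m * m - m * m + m\<^sup>2)"
      by (intro has_bochner_integral_add has_bochner_integral_diff has_bochner_integral_mult_right Y YY that)
         (simp add: has_bochner_integral_iff prob_space)
    then show ?thesis by (simp add: power2_eq_square algebra_simps split: if_splits)
  qed
  have "has_bochner_integral M (\<lambda>\<omega>. \<Sum>l<L. \<Sum>l'<L. (Y l \<omega> - m) * (Y l' \<omega> - m))
      (\<Sum>l<L. \<Sum>l'<L. if l = l' then c\<^sup>2 * \<kappa>' ^ K - m\<^sup>2 else 0)"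
    by (intro has_bochner_integral_sum cov) auto
  then have sum: "has_bochner_integral M (\<lambda>\<omega>. (\<Sum>l<L. Y l \<omega> - m)\<^sup>2) (L * (c\<^sup>2 * \<kappa>' ^ K - m\<^sup>2))"
    by (simp add: power2_eq_square sum_product)
  have eq: "((\<Sum>l<L. c * (\<Prod>p<K. E (K * l + p) \<omega>)) / L - m)\<^sup>2 = (\<Sum>l<L. Y l \<omega> - m)\<^sup>2 / L\<^sup>2" for \<omega>
  proof -
    have "c * (\<Prod>p<K. E (K * l + p) \<omega>) = Y l \<omega>" for l
      unfolding Y_def B_def using prod.shift_bounds_nat_ivl[of "\<lambda>p. E p \<omega>" 0 "K * l" K]
      by (simp add: atLeast0LessThan add.commute)
    then have "(\<Sum>l<L. c * (\<Prod>p<K. E (K * l + p) \<omega>)) / L - m = (\<Sum>l<L. Y l \<omega> - m) / L"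
      using \<open>0 < L\<close> by (simp add: sum_subtractf field_simps)
    then show ?thesis by (simp add: power_divide)
  qed
  have "has_bochner_integral M (\<lambda>\<omega>. (\<Sum>l<L. Y l \<omega> - m)\<^sup>2 / L\<^sup>2) (L * (c\<^sup>2 * \<kappa>' ^ K - m\<^sup>2) / L\<^sup>2)"
    by (rule has_bochner_integral_divide_zero[OF sum])
  then have "(\<integral>\<^sup>+ \<omega>. ennreal ((\<Sum>l<L. Y l \<omega> - m)\<^sup>2 / L\<^sup>2) \<partial>M) = ennreal (L * (c\<^sup>2 * \<kappa>' ^ K - m\<^sup>2) / L\<^sup>2)"
    by (subst nn_integral_eq_integral) (auto simp: has_bochner_integral_iff)
  also have "L * (c\<^sup>2 * \<kappa>' ^ K - m\<^sup>2) / L\<^sup>2 = (c\<^sup>2 * \<kappa>' ^ K - m\<^sup>2) / L"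
    by (simp add: power2_eq_square)
  \<comment> \<open>The subtracted m^2 only lowers the variance and is dropped.\<close>
  also have "ennreal \<dots> \<le> ennreal (c\<^sup>2 * \<kappa>' ^ K / L)"
    by (intro ennreal_leI divide_right_mono) auto
  finally show ?thesis unfolding m_def[symmetric] eq .
qed

text \<open>For a standard normal eta, exp(eta^2/8) has mean 1/sqrt(3/4), the case a = 1/8 of
  \<open>nn_integral_exp_square_normal\<close>; on a Wiener path a block has 2 2^(j-k) independent
  factors of this kind.\<close>

definition exp_mean_expectation :: "nat \<Rightarrow> nat \<Rightarrow> real" where
  "exp_mean_expectation j k = exp (- 4 * 2^(j-k)) * (1 / sqrt (3/4)) ^ (2 * 2^(j-k))"

lemma exp_minus_4_le: "exp (- 4 :: real) \<le> 1/16"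
proof -
  have "(2::real)^4 \<le> exp 1 ^ 4" using exp_ge_add_one_self[of 1] by (intro power_mono) auto
  also have "\<dots> = exp 4" by (simp flip: exp_of_nat_mult)
  finally show ?thesis by (simp add: exp_minus field_simps)
qed

lemma exp_mean_expectation_le: "exp_mean_expectation j k \<le> 1/4"
proof -
  define n :: nat where "n = 2^(j-k)"
  have n: "(2::real)^(j-k) = real n" "1 \<le> n" by (auto simp: n_def)
  \<comment> \<open>Each pair of half steps contributes exp(-4) times 4/3, which is below
    1/4.\<close>
  have "exp_mean_expectation j k = (exp (- 4) * (4/3)) ^ n"
    unfolding exp_mean_expectation_def n(1) n_def[symmetric] power_mult power_mult_distrib
    by (simp add: power_divide mult.commute flip: exp_of_nat_mult)
  also have "\<dots> \<le> (1/4) ^ n" using exp_minus_4_le by (intro power_mono) auto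
  also have "\<dots> \<le> (1/4) ^ 1" using n by (intro power_decreasing) auto
  finally show ?thesis by simp
qed

text \<open>Two half steps contribute exp(-8) times 2, at most 1/2. As n = 2^(j-k) >= j - k, the
  n-th power is at most 2^(k-j), and averaging over 2^k blocks supplies the factor 2^-k.\<close>

lemma variance_bound:
  assumes "k \<le> j"
  shows "(exp (- 4 * 2^(j-k)))\<^sup>2 * (1 / sqrt (1/2)) ^ (2 * 2^(j-k)) / real (2^k) \<le> 1 / 2^j"
proof -
  define n :: nat where "n = 2^(j-k)"
  have n: "(2::real)^(j-k) = real n" "j - k \<le> n" by (auto simp: n_def less_imp_le)
  have "(exp (- 4 * real n))\<^sup>2 * (1 / sqrt (1/2)) ^ (2 * n) = ((exp (- 4))\<^sup>2 * 2) ^ n"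
    unfolding power_mult power_mult_distrib
    by (simp add: power_divide mult.commute flip: exp_of_nat_mult power_mult)
  also have "\<dots> \<le> (1/2) ^ n"
  proof (rule power_mono)
    have "(exp (- 4::real))\<^sup>2 \<le> (1/16)\<^sup>2" using exp_minus_4_le by (intro power_mono) auto
    then show "(exp (- 4::real))\<^sup>2 * 2 \<le> 1/2" by (simp add: power2_eq_square)
  qed simp
  also have "\<dots> \<le> (1/2) ^ (j - k)" using n(2) by (intro power_decreasing) auto
  also have "\<dots> = 2^k / 2^j" using assms by (simp add: power_divide power_diff)
  finally show ?thesis unfolding n(1) n_def[symmetric] by (simp add: field_simps)
qed

text \<open>For fixed u the half step nodes of all blocks form one increasing grid, so independence
  of increments applies to all factors at once.\<close>

lemma wiener_variance:
  assumes W: "wiener_process M W" and u: "0 \<le> u" and "k \<le> j"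
  shows "(\<integral>\<^sup>+ \<omega>. ennreal ((exp_mean (\<lambda>t. W t \<omega>) j k u - exp_mean_expectation j k)\<^sup>2) \<partial>M) \<le> ennreal (1 / 2^j)"
proof -
  interpret prob_space M using W by (simp add: wiener_process_def)
  define ts where "ts p = (u + real p / 2) / 2^j" for p :: nat
  define s :: real where "s = sqrt (1 / 2^(j+1))"
  define X where "X p \<omega> = W (ts (Suc p)) \<omega> - W (ts p) \<omega>" for p \<omega>
  define E where "E p \<omega> = exp (2^j * (X p \<omega>)\<^sup>2 / 4)" for p \<omega>
  let ?K = "2 * 2^(j-k) :: nat"
  have ts: "0 \<le> ts p" "ts p < ts (Suc p)" "ts (Suc p) - ts p = 1 / 2^(j+1)" for p
    using u by (auto simp: ts_def divide_strict_right_mono diff_divide_distrib[symmetric])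
  have s: "0 < s" "s\<^sup>2 = 1 / 2^(j+1)" by (auto simp: s_def)
  have dist: "distributed M lborel (X p) (\<lambda>x. ennreal (normal_density 0 s x))" for p
    using W ts(1,2)[of p] unfolding wiener_process_def X_def[abs_def] s_def ts(3)[of p, symmetric] by blast
  have [measurable]: "X p \<in> borel_measurable M" for p
    using distributed_measurable[OF dist[of p]] by simp
  have "indep_vars (\<lambda>_. borel) X {..<n}" for n
  proof -
    have "0 \<le> ts 0 \<and> (\<forall>i<n. ts i \<le> ts (Suc i))" using ts(1,2) by (simp add: less_imp_le)
    then show ?thesis using W unfolding wiener_process_def X_def[abs_def] by blast
  qed
  then have indep: "indep_vars (\<lambda>_. borel) E {..<2^k * ?K}"
    unfolding E_def by (rule indep_vars_compose2) measurable
  have [measurable]: "E p \<in> borel_measurable M" for p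
    unfolding E_def[abs_def] by measurable
  have E1: "has_bochner_integral M (E p) (1 / sqrt (3/4))" for p
  proof (rule has_bochner_integral_nn_integral)
    \<comment> \<open>With s^2 = 2^(-j-1) the exponent 2^j X^2/4 is (X/s)^2/8; squaring doubles the
      coefficient to 1/4, still below 1/2.\<close>
    have "E p \<omega> = exp (1/8 * (X p \<omega> / s)\<^sup>2)" for \<omega>
      unfolding E_def power_divide s(2) by simp
    then show "(\<integral>\<^sup>+ \<omega>. ennreal (E p \<omega>) \<partial>M) = ennreal (1 / sqrt (3/4))"
      using nn_integral_exp_square_normal[OF dist s(1), of "1/8" p] by simp
  qed (auto simp: E_def)
  have E2: "has_bochner_integral M (\<lambda>\<omega>. (E p \<omega>)\<^sup>2) (1 / sqrt (1/2))" for p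
  proof (rule has_bochner_integral_nn_integral)
    have "(E p \<omega>)\<^sup>2 = exp (1/4 * (X p \<omega> / s)\<^sup>2)" for \<omega>
      unfolding E_def power_divide s(2) by (simp flip: exp_double)
    then show "(\<integral>\<^sup>+ \<omega>. ennreal ((E p \<omega>)\<^sup>2) \<partial>M) = ennreal (1 / sqrt (1/2))"
      using nn_integral_exp_square_normal[OF dist s(1), of "1/4" p] by simp
  qed (auto simp: E_def)
  have mean: "exp_mean (\<lambda>t. W t \<omega>) j k u
      = (\<Sum>l<2^k. exp (- 4 * 2^(j-k)) * (\<Prod>p<?K. E (?K * l + p) \<omega>)) / real (2^k)" for \<omega>
    by (simp add: exp_mean_def exp_block_def exp_incr_def half_incr_def E_def X_def ts_def)
  have "(\<integral>\<^sup>+ \<omega>. ennreal ((exp_mean (\<lambda>t. W t \<omega>) j k u - exp_mean_expectation j k)\<^sup>2) \<partial>M)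
      \<le> ennreal ((exp (- 4 * 2^(j-k)))\<^sup>2 * (1 / sqrt (1/2)) ^ ?K / real (2^k))"
    unfolding mean exp_mean_expectation_def
    by (rule nn_variance_mean_of_block_products[OF indep E1 E2]) simp
  also have "\<dots> \<le> ennreal (1 / 2^j)"
    by (intro ennreal_leI variance_bound \<open>k \<le> j\<close>)
  finally show ?thesis .
qed

section \<open>Joint measurability and almost sure finiteness\<close>

lemma borel_measurable_continuous_process:
  fixes X :: "real \<Rightarrow> 'a \<Rightarrow> real"
  assumes X [measurable]: "\<And>t. X t \<in> borel_measurable M"
    and cont: "\<And>\<omega>. \<omega> \<in> space M \<Longrightarrow> continuous_on UNIV (\<lambda>t. X t \<omega>)"
  shows "(\<lambda>(t, \<omega>). X t \<omega>) \<in> borel_measurable (borel \<Otimes>\<^sub>M M)"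
proof (rule borel_measurable_LIMSEQ_real)
  fix n :: nat
  \<comment> \<open>Time is rounded down to a grid of mesh 1/(n+1). The grid index takes countably
    many values, so each approximation is jointly measurable; path continuity then gives the
    limit.\<close>
  have "(\<lambda>p. X (of_int \<lfloor>real (Suc n) * fst p\<rfloor> / real (Suc n)) (snd p)) \<in> borel_measurable (borel \<Otimes>\<^sub>M M)"
    by (rule measurable_compose_countable[where f = "\<lambda>i p. X (of_int i / real (Suc n)) (snd p)"]) measurable
  then show "(\<lambda>(t, \<omega>). X (of_int \<lfloor>real (Suc n) * t\<rfloor> / real (Suc n)) \<omega>) \<in> borel_measurable (borel \<Otimes>\<^sub>M M)"
    by (simp add: case_prod_beta')
next
  fix p :: "real \<times> 'a" assume "p \<in> space (borel \<Otimes>\<^sub>M M)"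
  then obtain t \<omega> where p: "p = (t, \<omega>)" "\<omega> \<in> space M" by (auto simp: space_pair_measure)
  have "(\<lambda>n. of_int \<lfloor>real (Suc n) * t\<rfloor> / real (Suc n) - t) \<longlonglongrightarrow> 0"
  proof (rule Lim_null_comparison[OF _ LIMSEQ_inverse_real_of_nat], intro always_eventually allI)
    fix n
    have "of_int \<lfloor>real (Suc n) * t\<rfloor> / real (Suc n) - t = (of_int \<lfloor>real (Suc n) * t\<rfloor> - real (Suc n) * t) / real (Suc n)"
      by (simp add: field_simps)
    then have "norm (of_int \<lfloor>real (Suc n) * t\<rfloor> / real (Suc n) - t) = \<bar>of_int \<lfloor>real (Suc n) * t\<rfloor> - real (Suc n) * t\<bar> / real (Suc n)"
      by (simp only: real_norm_def abs_divide abs_of_nat)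
    also have "\<dots> \<le> 1 / real (Suc n)"
      by (intro divide_right_mono) linarith+
    finally show "norm (of_int \<lfloor>real (Suc n) * t\<rfloor> / real (Suc n) - t) \<le> inverse (real (Suc n))"
      by (simp only: inverse_eq_divide)
  qed
  then have "(\<lambda>n. of_int \<lfloor>real (Suc n) * t\<rfloor> / real (Suc n)) \<longlonglongrightarrow> t"
    by (simp only: LIM_zero_iff)
  moreover have "isCont (\<lambda>t. X t \<omega>) t"
    using cont[OF p(2)] by (simp add: continuous_on_eq_continuous_at)
  ultimately show "(\<lambda>n. case p of (t, \<omega>) \<Rightarrow> X (of_int \<lfloor>real (Suc n) * t\<rfloor> / real (Suc n)) \<omega>)
      \<longlonglongrightarrow> (case p of (t, \<omega>) \<Rightarrow> X t \<omega>)"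
    unfolding p(1) prod.case by (rule isCont_tendsto_compose[rotated])
qed

lemma normD_cong: "(\<And>x. x \<in> {0..1} \<Longrightarrow> f x = g x) \<Longrightarrow> normD f = normD g"
  unfolding normD_def D2_def using Delta2_cong[of f g] by simp

lemma AE_normD_finite:
  assumes W: "wiener_process M W"
  shows "AE \<omega> in M. normD (\<lambda>t. W t \<omega>) < \<infinity>"
proof -
  interpret prob_space M using W by (simp add: wiener_process_def)
  have "AE \<omega> in M. continuous_on {0..} (\<lambda>t. W t \<omega>)" using W by (simp add: wiener_process_def)
  then obtain N where N: "{\<omega> \<in> space M. \<not> continuous_on {0..} (\<lambda>t. W t \<omega>)} \<subseteq> N" "N \<in> null_sets M"
    by (auto elim!: AE_E intro: null_setsI)
  have [measurable]: "N \<in> sets M" using N(2) by auto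
  \<comment> \<open>The paths are only almost surely continuous; the modification makes the process jointly measurable.\<close>
  define X where "X t \<omega> = (if \<omega> \<in> N then 0 else W (max 0 t) \<omega>)" for t \<omega>
  have "W (max 0 t) \<in> borel_measurable M" for t using W by (simp add: wiener_process_def)
  then have X: "X t \<in> borel_measurable M" for t unfolding X_def by measurable
  have cont: "continuous_on UNIV (\<lambda>t. X t \<omega>)" if "\<omega> \<in> space M" for \<omega>
  proof (cases "\<omega> \<in> N")
    case False
    then have "continuous_on {0..} (\<lambda>t. W t \<omega>)" using N(1) that by auto
    \<comment> \<open>Freezing negative times at time 0 extends continuity from the half line to the
      whole line, as \<open>normD_finite\<close> asks.\<close>
    then have "continuous_on UNIV (\<lambda>t. W (max 0 t) \<omega>)"
      by (rule continuous_on_compose2) (auto intro!: continuous_intros)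
    then show ?thesis using False by (simp add: X_def)
  qed (simp add: X_def)
  have XW: "AE \<omega> in M. \<forall>t\<ge>0. X t \<omega> = W t \<omega>"
    using AE_not_in[OF N(2)] by eventually_elim (simp add: X_def)
  have X_joint: "(\<lambda>x. X (g x) (h x)) \<in> borel_measurable Q"
    if "g \<in> borel_measurable Q" "h \<in> Q \<rightarrow>\<^sub>M M" for g h and Q :: "(real \<times> 'a) measure"
    using measurable_compose[OF measurable_Pair[OF that] borel_measurable_continuous_process[OF X cont]] by simp
  define F where "F j k u \<omega> = ennreal ((exp_mean (\<lambda>t. X t \<omega>) j k u - exp_mean_expectation j k)\<^sup>2) * indicator {0..1} u"
    for j k u \<omega>
  have "(\<lambda>x. exp_mean (\<lambda>t. X t (snd x)) j k (fst x)) \<in> borel_measurable (lborel \<Otimes>\<^sub>M M)" for j k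
    unfolding exp_mean_def exp_block_def exp_incr_def half_incr_def
    by (intro borel_measurable_divide borel_measurable_sum borel_measurable_times borel_measurable_prod
        borel_measurable_const borel_measurable_exp[THEN measurable_compose[rotated]]
        borel_measurable_power borel_measurable_diff X_joint) measurable
  then have F [measurable]: "(\<lambda>(u, \<omega>). F j k u \<omega>) \<in> borel_measurable (lborel \<Otimes>\<^sub>M M)" for j k
    unfolding F_def case_prod_beta' by measurable
  interpret pair_sigma_finite lborel M ..
  define V where "V \<omega> j = (\<Sum>k\<le>j. exp_variance (exp_mean_expectation j k) (\<lambda>t. X t \<omega>) j k)" for \<omega> j
  have V_F: "exp_variance (exp_mean_expectation j k) (\<lambda>t. X t \<omega>) j k = (\<integral>\<^sup>+ u. F j k u \<omega> \<partial>lborel)" for \<omega> j k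
    by (simp add: exp_variance_def F_def)
  have [measurable]: "(\<lambda>\<omega>. V \<omega> j) \<in> borel_measurable M" for j
    unfolding V_def V_F by measurable
  have "(\<integral>\<^sup>+ \<omega>. V \<omega> j \<partial>M) \<le> ennreal (real (Suc j) * (1/2)^j)" for j
  proof -
    have F_le: "(\<integral>\<^sup>+ \<omega>. F j k u \<omega> \<partial>M) \<le> ennreal (1 / 2^j) * indicator {0..1} u" if "k \<le> j" for k u
    proof (cases "u \<in> {0..1}")
      case True
      have "(\<integral>\<^sup>+ \<omega>. F j k u \<omega> \<partial>M)
          = (\<integral>\<^sup>+ \<omega>. ennreal ((exp_mean (\<lambda>t. W t \<omega>) j k u - exp_mean_expectation j k)\<^sup>2) \<partial>M)"
      proof (intro nn_integral_cong_AE, use XW in eventually_elim)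
        fix \<omega> assume "\<forall>t\<ge>0. X t \<omega> = W t \<omega>"
        then show "F j k u \<omega> = ennreal ((exp_mean (\<lambda>t. W t \<omega>) j k u - exp_mean_expectation j k)\<^sup>2)"
          using True by (simp add: F_def exp_mean_def exp_block_def exp_incr_def half_incr_def)
      qed
      also have "\<dots> \<le> ennreal (1 / 2^j)" using True that by (intro wiener_variance W) auto
      finally show ?thesis using True by simp
    qed (simp add: F_def)
    have "(\<integral>\<^sup>+ \<omega>. V \<omega> j \<partial>M) = (\<Sum>k\<le>j. \<integral>\<^sup>+ \<omega>. \<integral>\<^sup>+ u. F j k u \<omega> \<partial>lborel \<partial>M)"
      unfolding V_def V_F by (intro nn_integral_sum) measurable
    \<comment> \<open>Tonelli moves the expectation inside, where the bound for fixed u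
      applies.\<close>
    also have "\<dots> = (\<Sum>k\<le>j. \<integral>\<^sup>+ u. \<integral>\<^sup>+ \<omega>. F j k u \<omega> \<partial>M \<partial>lborel)"
      by (intro sum.cong refl Fubini' F)
    also have "\<dots> \<le> (\<Sum>k\<le>j. \<integral>\<^sup>+ u. ennreal (1 / 2^j) * indicator {0..1::real} u \<partial>lborel)"
    proof (rule sum_mono)
      fix k assume "k \<in> {..j}"
      then have "k \<le> j" by simp
      show "(\<integral>\<^sup>+ u. \<integral>\<^sup>+ \<omega>. F j k u \<omega> \<partial>M \<partial>lborel) \<le> (\<integral>\<^sup>+ u. ennreal (1 / 2^j) * indicator {0..1::real} u \<partial>lborel)"
        by (intro nn_integral_mono F_le \<open>k \<le> j\<close>)
    qed
    also have "\<dots> = (\<Sum>k\<le>j. ennreal (1 / 2^j))"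
      by (subst nn_integral_cmult_indicator) auto
    also have "\<dots> = ennreal (real (Suc j) * (1/2)^j)"
      by (subst sum_ennreal) (auto simp: power_divide)
    finally show ?thesis .
  qed
  \<comment> \<open>The bounds (j+1) 2^-j are summable, so the sum of all variances has finite
    expectation and is finite almost surely.\<close>
  then have "(\<integral>\<^sup>+ \<omega>. (\<Sum>j. V \<omega> j) \<partial>M) \<le> (\<Sum>j. ennreal (real (Suc j) * (1/2)^j))"
    by (subst nn_integral_suminf) (auto intro!: suminf_le)
  also have "\<dots> < \<infinity>"
    using geometric_deriv_sums[of "1/2::real"]
    by (subst suminf_ennreal2) (auto simp: sums_iff)
  finally have "AE \<omega> in M. (\<Sum>j. V \<omega> j) \<noteq> \<infinity>"
    by (intro nn_integral_PInf_AE) auto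
  then show ?thesis using XW AE_space
  proof eventually_elim
    case (elim \<omega>)
    have "normD (\<lambda>t. X t \<omega>) < \<infinity>"
    proof (rule normD_finite[OF cont[OF elim(3)] exp_mean_expectation_le])
      show "(\<Sum>j. \<Sum>k\<le>j. exp_variance (exp_mean_expectation j k) (\<lambda>t. X t \<omega>) j k) < \<infinity>"
        using elim(1) by (simp add: V_def less_top)
    qed
    \<comment> \<open>The norm reads only times in [0,1], where X and W agree.\<close>
    also have "normD (\<lambda>t. X t \<omega>) = normD (\<lambda>t. W t \<omega>)"
      using elim(2) by (intro normD_cong) auto
    finally show ?case .
  qed
qed

theorem theorem2p12:
  shows "(\<exists>c C::real. 0 < c \<and> c \<le> C \<and>
            (\<forall>f::real \<Rightarrow> real. continuous_on {0..1} f \<longrightarrow>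
               ennreal c * normD f \<le> normfrakD f \<and> normfrakD f \<le> ennreal C * normD f))
       \<and> (\<forall>(M::'a measure) W. wiener_process M W \<longrightarrow> (AE \<omega> in M. normD (\<lambda>t. W t \<omega>) < \<infinity>))
       \<and> (\<forall>(M::'a measure) W. wiener_process M W \<longrightarrow> (AE \<omega> in M. normfrakD (\<lambda>t. W t \<omega>) < \<infinity>))"
proof (intro conjI allI impI)
  \<comment> \<open>The lower constant 1/6 inverts the factor 6 of \<open>normD_le\<close>.\<close>
  have "ennreal (1/6) * normD f \<le> normfrakD f" if "continuous_on {0..1} f" for f
  proof -
    have "ennreal (1/6) * normD f \<le> ennreal (1/6) * (ennreal 6 * normfrakD f)"
      using normD_le[OF that] by (intro mult_left_mono) auto
    also have "\<dots> = ennreal (1/6 * 6) * normfrakD f"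
      by (subst ennreal_mult) (auto simp: mult.assoc)
    also have "\<dots> = normfrakD f" by simp
    finally show ?thesis .
  qed
  then show "\<exists>c C::real. 0 < c \<and> c \<le> C \<and>
            (\<forall>f::real \<Rightarrow> real. continuous_on {0..1} f \<longrightarrow>
               ennreal c * normD f \<le> normfrakD f \<and> normfrakD f \<le> ennreal C * normD f)"
    using normfrakD_le by (intro exI[of _ "1/6"] exI[of _ 6]) auto
next
  fix M :: "'a measure" and W assume W: "wiener_process M W"
  then show "AE \<omega> in M. normD (\<lambda>t. W t \<omega>) < \<infinity>" by (rule AE_normD_finite)
  have "AE \<omega> in M. continuous_on {0..} (\<lambda>t. W t \<omega>)" using W by (simp add: wiener_process_def)
  with AE_normD_finite[OF W] show "AE \<omega> in M. normfrakD (\<lambda>t. W t \<omega>) < \<infinity>"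
  proof eventually_elim
    case (elim \<omega>)
    \<comment> \<open>Continuity of almost every path lets the comparison transfer finiteness from
      the dyadic norm.\<close>
    have "continuous_on {0..1} (\<lambda>t. W t \<omega>)" by (rule continuous_on_subset[OF elim(2)]) auto
    then have "normfrakD (\<lambda>t. W t \<omega>) \<le> 6 * normD (\<lambda>t. W t \<omega>)" by (rule normfrakD_le)
    also have "\<dots> < \<infinity>" using elim(1) by (simp add: ennreal_mult_less_top)
    finally show ?case .
  qed
qed

end
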